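(* Let $n\ge1$ and $\lambda=(n^n)$ (the $n\times n$ square partition). Then $$\sum_{\pi\in\mathcal S_{\lambda}} z^{\operatorname{diags}(\pi)}q^{\operatorname{area}(\pi)}t^{\operatorname{dinv}(\pi)} = (qt)^{n^2(n-1)/2}\prod_{\substack{i,j\ge0\\ i+j<n}}(z+q^it^j).$$
   Context: For $\lambda=(n^n)$, set $k=n-1$ and $n_j=2n-1-2j$ for $j=0,\dots,n-1$, and $\operatorname{adj}(\lambda)=\binom n2$ (these are the border-strip lengths and dinv adjustment of the square partition). $\mathcal S_\lambda$ is the set of tuples $\pi=(\pi_0,\dots,\pi_k)$ of pairwise non-intersecting lattice paths with steps $(0,1)$ (north), $(1,0)$ (east), $(1,1)$ (diagonal), never going strictly below $y=x$, with $\pi_j$ from $(j,j)$ to $(j+n_j,j+n_j)$. $\operatorname{diags}(\pi)$ is the total number of diagonal steps. An area triangle is a triangle with vertices $(c,e),(c+1,e),(c+1,e+1)$, $c,e\in\mathbb Z$. For $j\le i\le j+n_j-1$, $a^{(j)}_i$ is the number of area triangles in the strip $i\le y\le i+1$ to the right of $\pi_j$ and to the left of $y=x$; it is called decorated if $\pi_j$ has a diagonal step in that strip. $\operatorname{area}(\pi)=\sum_{j,i}a^{(j)}_i$. A dinv pair is an ordered pair of distinct entries $(a^{(u)}_b,a^{(v)}_c)$ with either (1) $a^{(u)}_b=a^{(v)}_c$, $b<c$, and $a^{(u)}_b$ undecorated, or (2) $a^{(u)}_b=a^{(v)}_c+1$, $b\le c$, and $a^{(v)}_c$ undecorated (only numerical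 values compared). $\operatorname{dinv}(\pi)=\operatorname{adj}(\lambda)+\#\{\text{dinv pairs in }\pi\}$. *)

theory Defs
  imports Main "HOL-Library.Product_Plus"
begin

text \<open>
  Lattice paths are represented by the list of the lattice points they visit, in order;
  a tuple \<open>\<pi> = (\<pi>\<^sub>0, \<dots>, \<pi>\<^sub>k)\<close> is the list of its components.
\<close>

type_synonym point = "int \<times> int"
type_synonym path = "point list"

definition lattice_step :: "point \<Rightarrow> point \<Rightarrow> bool" where
  "lattice_step p p' \<longleftrightarrow> p' - p \<in> {(0, 1), (1, 0), (1, 1)}"

definition is_lattice_path :: "point \<Rightarrow> point \<Rightarrow> path \<Rightarrow> bool" where
  "is_lattice_path p p' w \<longleftrightarrow>
     w \<noteq> [] \<and> hd w = p \<and> last w = p' \<and> successively lattice_step w"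

definition path_steps :: "path \<Rightarrow> (point \<times> point) list" where
  "path_steps w = zip w (tl w)"

definition weakly_above_diagonal :: "path \<Rightarrow> bool" where
  "weakly_above_diagonal w \<longleftrightarrow> (\<forall>(x, y)\<in>set w. x \<le> y)"

text \<open>
  North and east steps run along grid lines, and the interior of a diagonal step meets no grid
  line. Hence two paths meet as plane curves iff they have a lattice point in common.
\<close>

definition non_intersecting :: "path \<Rightarrow> path \<Rightarrow> bool" where
  "non_intersecting w w' \<longleftrightarrow> set w \<inter> set w' = {}"

text \<open>
  The data of the partition \<open>(n\<^sup>n)\<close>: the border-strip lengths \<open>n\<^sub>j\<close>, for \<open>j < n\<close>, and the
  dinv adjustment. For \<open>j < n\<close> the subtractions on \<^typ>\<open>nat\<close> do not truncate.
\<close>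

definition strip_length :: "nat \<Rightarrow> nat \<Rightarrow> nat" where
  "strip_length n j = 2 * n - 1 - 2 * j"

definition adj :: "nat \<Rightarrow> nat" where
  "adj n = n choose 2"

definition path_tuples :: "nat \<Rightarrow> path list set" where
  "path_tuples n = {\<pi>. length \<pi> = n \<and>
     (\<forall>j<n. is_lattice_path (int j, int j)
               (int (j + strip_length n j), int (j + strip_length n j)) (\<pi> ! j) \<and>
             weakly_above_diagonal (\<pi> ! j)) \<and>
     (\<forall>i<n. \<forall>j<n. i \<noteq> j \<longrightarrow> non_intersecting (\<pi> ! i) (\<pi> ! j))}"

definition diags :: "path list \<Rightarrow> nat" where
  "diags \<pi> = (\<Sum>w\<leftarrow>\<pi>. length (filter (\<lambda>(p, p'). p' - p = (1, 1)) (path_steps w)))"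

text \<open>The vertices of an area triangle; by convexity they suffice to locate the triangle relative
  to a line.\<close>

definition area_triangle :: "int \<Rightarrow> int \<Rightarrow> point set" where
  "area_triangle c e = {(c, e), (c + 1, e), (c + 1, e + 1)}"

text \<open>Position of a point relative to the line through an upward step, by the sign of a
  cross product.\<close>

fun weakly_right_of :: "point \<times> point \<Rightarrow> point \<Rightarrow> bool" where
  "weakly_right_of ((x0, y0), (x1, y1)) (x, y) \<longleftrightarrow>
     (x1 - x0) * (y - y0) \<le> (x - x0) * (y1 - y0)"

text \<open>
  The strip \<open>i \<le> y \<le> i + 1\<close> is crossed by exactly one north or diagonal step of a path starting
  at height at most \<open>i\<close> and ending at height at least \<open>i + 1\<close>; within the strip, lying to the right
  of the path means lying to the right of this step.
\<close>

definition row_area :: "path \<Rightarrow> nat \<Rightarrow> nat" where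
  "row_area w i = card {c. (\<exists>(p, p')\<in>set (path_steps w). snd p = int i \<and> snd p' = int i + 1 \<and>
        (\<forall>r\<in>area_triangle c (int i). weakly_right_of (p, p') r)) \<and>
     (\<forall>(x, y)\<in>area_triangle c (int i). x \<le> y)}"

definition decorated :: "path \<Rightarrow> nat \<Rightarrow> bool" where
  "decorated w i \<longleftrightarrow> (\<exists>x. ((x, int i), (x + 1, int i + 1)) \<in> set (path_steps w))"

text \<open>The index \<open>(j, i)\<close> stands for the entry \<open>a\<^sup>(\<^sup>j\<^sup>)\<^sub>i\<close>.\<close>

definition entry_indices :: "nat \<Rightarrow> (nat \<times> nat) set" where
  "entry_indices n = (SIGMA j:{..<n}. {j..<j + strip_length n j})"

definition area :: "nat \<Rightarrow> path list \<Rightarrow> nat" where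
  "area n \<pi> = (\<Sum>(j, i)\<in>entry_indices n. row_area (\<pi> ! j) i)"

definition dinv_pairs :: "nat \<Rightarrow> path list \<Rightarrow> ((nat \<times> nat) \<times> (nat \<times> nat)) set" where
  "dinv_pairs n \<pi> = {((u, b), (v, c)).
     (u, b) \<in> entry_indices n \<and> (v, c) \<in> entry_indices n \<and> (u, b) \<noteq> (v, c) \<and>
     (row_area (\<pi> ! u) b = row_area (\<pi> ! v) c \<and> b < c \<and> \<not> decorated (\<pi> ! u) b \<or>
      row_area (\<pi> ! u) b = row_area (\<pi> ! v) c + 1 \<and> b \<le> c \<and> \<not> decorated (\<pi> ! v) c)}"

definition dinv :: "nat \<Rightarrow> path list \<Rightarrow> nat" where
  "dinv n \<pi> = adj n + card (dinv_pairs n \<pi>)"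

lemma finite_lattice_paths: "finite {w. is_lattice_path p p' w}"
proof -
  define P :: "point \<Rightarrow> point \<Rightarrow> bool"
    where "P = (\<lambda>a b. fst a \<le> fst b \<and> snd a \<le> snd b \<and> a \<noteq> b)"
  have tr: "transp P"
    unfolding P_def transp_def by (auto simp: prod_eq_iff)
  have step: "lattice_step a b \<Longrightarrow> P a b" for a b
    unfolding P_def lattice_step_def by (cases a; cases b) auto
  have "set w \<subseteq> {fst p..fst p'} \<times> {snd p..snd p'} \<and> distinct w"
    if "is_lattice_path p p' w" for w
  proof -
    have ne: "w \<noteq> []" and h: "hd w = p" and l: "last w = p'"
      and "successively lattice_step w"
      using that by (auto simp: is_lattice_path_def)
    then have "successively P w"
      using step by (auto intro: successively_mono)
    then have s: "sorted_wrt P w"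
      using tr successively_conv_sorted_wrt by blast
    have "distinct w"
      using s by (induction w) (auto simp: P_def)
    moreover have "fst p \<le> fst r \<and> snd p \<le> snd r" if "r \<in> set w" for r
      using s h that by (cases w) (auto simp: P_def)
    moreover have "fst r \<le> fst p' \<and> snd r \<le> snd p'" if "r \<in> set w" for r
      using s l that by (cases w rule: rev_cases) (auto simp: P_def sorted_wrt_append)
    ultimately show ?thesis
      by (auto simp: mem_Times_iff)
  qed
  then have "{w. is_lattice_path p p' w} \<subseteq>
      {w. set w \<subseteq> {fst p..fst p'} \<times> {snd p..snd p'} \<and> distinct w}"
    by blast
  then show ?thesis
    by (rule finite_subset) (intro finite_subset_distinct, simp)
qed

lemma finite_path_tuples: "finite (path_tuples n)"
proof -
  let ?A = "\<Union>j<n. {w. is_lattice_path (int j, int j)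
    (int (j + strip_length n j), int (j + strip_length n j)) w}"
  have "path_tuples n \<subseteq> {\<pi>. set \<pi> \<subseteq> ?A \<and> length \<pi> = n}"
    unfolding path_tuples_def in_set_conv_nth subset_iff by blast
  moreover have "finite ?A"
    using finite_lattice_paths by blast
  ultimately show ?thesis
    using finite_lists_length_eq[of ?A n] finite_subset by blast
qed

end

theory Submission
  imports Defs "HOL-Library.Multiset"
begin

text \<open>
  The strips below height \<open>n - 1\<close> are frozen: their entries are \<open>i, \<dots>, 1, 0\<close>, all undecorated. The
  entries of the remaining strips form a monotone triangle \<open>a\<close>, and a tuple of paths amounts to \<open>a\<close>
  together with the set \<open>U\<close> of its undecorated entries, subject to interlacing conditions on \<open>a\<close> and
  on the array \<open>b\<close> obtained from \<open>a\<close> by adding 1 on \<open>U\<close>. For fixed \<open>a\<close> the dinv statistic is an affine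
  function of \<open>U\<close>, and so it is for fixed \<open>b\<close>; hence the sum over \<open>U\<close> factors in both cases.

  As in domino shuffling, the arrays \<open>b\<close> of order \<open>m\<close> are, up to a shift, the triangles \<open>a\<close> of order
  \<open>m + 1\<close>. For a common triangle, the entries forced into or out of \<open>U\<close> correspond, with equal
  weights, and the factors \<open>z + w t\<^sup>e\<close> of the free entries differ exactly by those with
  \<open>e = 0, \<dots>, m\<close>. This comparison of the exponents is an energy argument: let \<open>f\<^sub>r v\<close> be the exponent
  of the value \<open>v\<close> in row \<open>r\<close>. Each entry \<open>v\<close> of row \<open>r + 1\<close> moves one unit of \<open>f\<close> from the site \<open>v\<close> to
  the site \<open>v - 1\<close>, so the multiset of all \<open>e < f\<^sub>r v\<close> loses one exponent that occurs on the one side and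
  gains one that occurs on the other; summing over the rows telescopes. The resulting recursion
  multiplies \<open>w\<close> by \<open>q\<close> and yields the product.
\<close>

section \<open>Monotone triangles and exponents\<close>

definition tri :: "nat \<Rightarrow> (nat \<times> nat) set" where
  "tri n = {(r, u). r + u < n}"

lemma tri_Sigma: "tri n = (SIGMA r:{..<n}. {..<n - r})"
  by (auto simp: tri_def)

lemma finite_tri [simp]: "finite (tri n)"
  by (simp add: tri_Sigma)

lemma mem_tri [simp]: "(r, u) \<in> tri n \<longleftrightarrow> r + u < n"
  by (simp add: tri_def)

lemma sum_tri: "sum f (tri n) = (\<Sum>r<n. \<Sum>u<n - r. f (r, u))"
  by (simp add: tri_Sigma sum.Sigma)

lemma sum_tri_Suc:
  "sum f (tri (Suc m)) = (\<Sum>u\<le>m. f (0, u)) + (\<Sum>(r, u)\<in>tri m. f (Suc r, u))"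
  unfolding sum_tri sum.lessThan_Suc_shift by (simp add: lessThan_Suc_atMost)

text \<open>The index \<open>(r, u)\<close> stands for the strip \<open>n - 1 + r\<close> and the path \<open>u\<close>.\<close>

definition monotone_triangles :: "nat \<Rightarrow> (nat \<times> nat \<Rightarrow> nat) set" where
  "monotone_triangles n = {a. (\<forall>p. p \<notin> tri n \<longrightarrow> a p = 0) \<and> (\<forall>u<n. a (0, u) = n - 1 - u) \<and>
     (\<forall>r u. r + Suc u < n \<longrightarrow> a (r, Suc u) < a (r, u) \<and> a (r, Suc u) < a (Suc r, u) \<and>
        a (Suc r, u) \<le> Suc (a (r, u)))}"

definition raised :: "(nat \<times> nat \<Rightarrow> nat) \<Rightarrow> (nat \<times> nat) set \<Rightarrow> nat \<times> nat \<Rightarrow> nat" where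
  "raised a U p = a p + of_bool (p \<in> U)"

definition configs :: "nat \<Rightarrow> ((nat \<times> nat \<Rightarrow> nat) \<times> (nat \<times> nat) set) set" where
  "configs n = {(a, U). U \<subseteq> tri n \<and> (\<forall>p. p \<notin> tri n \<longrightarrow> a p = 0) \<and> (\<forall>u<n. a (0, u) = n - 1 - u) \<and>
     (\<forall>r u. r + Suc u < n \<longrightarrow> raised a U (r, Suc u) < a (Suc r, u) \<and> a (Suc r, u) \<le> raised a U (r, u))}"

text \<open>The number of dinv pairs gained by removing the decoration of an entry \<open>v\<close> in row \<open>r\<close>. The last
  summand, truncated at 0, counts the frozen entries \<open>v + 1\<close>.\<close>

definition rate :: "nat \<Rightarrow> (nat \<times> nat \<Rightarrow> nat) \<Rightarrow> nat \<Rightarrow> nat \<Rightarrow> nat" where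
  "rate n a r v = (\<Sum>p\<in>tri n. of_bool (r < fst p \<and> a p = v) + of_bool (fst p \<le> r \<and> a p = Suc v))
     + (n - 2 - v)"

section \<open>Telescoping multisets of exponents\<close>

lemma sum_if_mem:
  fixes h :: "nat \<Rightarrow> 'b multiset"
  assumes "A \<subseteq> {..<K}"
  shows "(\<Sum>v<K. if v \<in> A then h v else {#}) = (\<Sum>v\<in>A. h v)"
proof -
  have "(\<Sum>v\<in>A. h v) = sum h ({..<K} \<inter> A)"
    using assms by (simp add: Int_absorb1)
  also have "\<dots> = (\<Sum>v<K. if v \<in> A then h v else {#})"
    by (subst sum.inter_restrict) auto
  finally show ?thesis ..
qed

text \<open>The identity holds site by site. A site with \<open>v\<close> and \<open>Suc v\<close>
  both in \<open>A\<close>, or neither, keeps its value. A unit arriving at \<open>v\<close> adds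
  the exponent \<open>f v\<close>; a unit leaving \<open>v\<close> removes the exponent
  \<open>g v\<close>. Since \<open>0 \<notin> A\<close>, the site \<open>v - 1\<close> always
  exists.\<close>

lemma energy_step:
  fixes f g :: "nat \<Rightarrow> nat"
  assumes fg: "\<And>v. f v + of_bool (Suc v \<in> A) = g v + of_bool (v \<in> A)"
    and A: "A \<subseteq> {0<..<K}"
  shows "(\<Sum>v<K. mset_set {..<f v}) + (\<Sum>v\<in>A. {#f (v - 1)#})
    = (\<Sum>v<K. mset_set {..<g v}) + (\<Sum>v\<in>A. {#g v#})"
proof -
  have *: "mset_set {..<f v} + (if Suc v \<in> A then {#f v#} else {#})
      = mset_set {..<g v} + (if v \<in> A then {#g v#} else {#})" for v
  proof (cases "Suc v \<in> A \<and> v \<notin> A")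
    case True
    then have "g v = Suc (f v)" using fg[of v] by simp
    with True show ?thesis by (simp add: lessThan_Suc)
  next
    case False
    then show ?thesis using fg[of v] by (cases "v \<in> A") (auto simp: lessThan_Suc)
  qed
  have "(\<Sum>v<K. if Suc v \<in> A then {#f v#} else {#}) = (\<Sum>v\<in>{v. Suc v \<in> A}. {#f v#})"
    using A sum_if_mem[of "{v. Suc v \<in> A}" K "\<lambda>v. {#f v#}"] by fastforce
  also have "\<dots> = (\<Sum>v\<in>A. {#f (v - 1)#})"
    by (rule sum.reindex_bij_witness[of _ "\<lambda>v. v - 1" Suc]) (use A in auto)
  finally have f: "(\<Sum>v<K. if Suc v \<in> A then {#f v#} else {#}) = (\<Sum>v\<in>A. {#f (v - 1)#})" .
  have g: "(\<Sum>v<K. if v \<in> A then {#g v#} else {#}) = (\<Sum>v\<in>A. {#g v#})"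
    by (rule sum_if_mem) (use A in auto)
  have "(\<Sum>v<K. mset_set {..<f v} + (if Suc v \<in> A then {#f v#} else {#}))
      = (\<Sum>v<K. mset_set {..<g v} + (if v \<in> A then {#g v#} else {#}))"
    by (rule sum.cong[OF refl *])
  then show ?thesis
    unfolding sum.distrib f g .
qed

lemma triangle_row_antimono:
  assumes "a \<in> monotone_triangles n" "u < v" "r + v < n"
  shows "a (r, v) < a (r, u)"
  using assms(2,3)
proof (induction v)
  case (Suc v)
  then have "a (r, Suc v) < a (r, v)"
    using assms(1) by (simp add: monotone_triangles_def)
  moreover have "a (r, v) \<le> a (r, u)"
    using Suc by (cases "u = v") auto
  ultimately show ?case by simp
qed simp

lemma triangle_row_inj:
  assumes "a \<in> monotone_triangles n"
  shows "inj_on (\<lambda>u. a (r, u)) {..<n - r}"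
proof (rule linorder_inj_onI)
  fix u v assume "u < v" "u \<in> {..<n - r}" "v \<in> {..<n - r}"
  then show "a (r, u) \<noteq> a (r, v)"
    using triangle_row_antimono[OF assms, of u v r] by (simp add: less_diff_conv add.commute)
qed auto

text \<open>Row 0 lies below \<open>n\<close>, and each further row raises the bound by 1. So all
  entries are below \<open>2 * n\<close>, which gives finiteness and a cutoff for the sites.\<close>

lemma triangle_bound:
  assumes "a \<in> monotone_triangles n" "r + u < n"
  shows "a (r, u) < n + r"
  using assms(2)
proof (induction r arbitrary: u)
  case (Suc r)
  then have "a (Suc r, u) \<le> Suc (a (r, u))"
    using assms(1) by (simp add: monotone_triangles_def)
  then show ?case using Suc.IH[of u] Suc.prems by simp
next
  case 0
  then show ?case using assms(1) by (auto simp: monotone_triangles_def)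
qed

text \<open>Makes the predecessor \<open>a (Suc r, u) - 1\<close> genuine.\<close>

lemma triangle_pos:
  assumes "a \<in> monotone_triangles n" "Suc r + u < n"
  shows "0 < a (Suc r, u)"
  using assms by (auto simp: monotone_triangles_def intro: le_less_trans[of 0 "a (r, Suc u)"])

lemma finite_monotone_triangles: "finite (monotone_triangles n)"
proof (rule finite_subset)
  show "monotone_triangles n \<subseteq>
      {a. \<forall>p. (p \<in> tri n \<longrightarrow> a p \<in> {..<2 * n}) \<and> (p \<notin> tri n \<longrightarrow> a p = 0)}"
  proof (intro subsetI CollectI allI conjI impI)
    fix a p assume a: "a \<in> monotone_triangles n"
    {
      assume "p \<in> tri n"
      then show "a p \<in> {..<2 * n}"
        using triangle_bound[OF a, of "fst p" "snd p"] by (cases p) auto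
    next
      assume "p \<notin> tri n"
      then show "a p = 0"
        using a unfolding monotone_triangles_def by blast
    }
  qed
  show "finite {a :: nat \<times> nat \<Rightarrow> nat. \<forall>p. (p \<in> tri n \<longrightarrow> a p \<in> {..<2 * n}) \<and> (p \<notin> tri n \<longrightarrow> a p = 0)}"
    by (rule finite_set_of_finite_funs) auto
qed

lemma sum_row_indicator:
  assumes "inj_on (\<lambda>u. a (r, u)) {..<n - r}" "r < n"
  shows "(\<Sum>p\<in>tri n. of_bool (fst p = r \<and> a p = v))
    = (of_bool (v \<in> (\<lambda>u. a (r, u)) ` {..<n - r}) :: nat)"
proof -
  have "(\<Sum>p\<in>tri n. of_bool (fst p = r \<and> a p = v) :: nat)
      = card {p \<in> tri n. fst p = r \<and> a p = v}"
    by (simp add: sum_of_bool_eq Int_def)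
  also have "{p \<in> tri n. fst p = r \<and> a p = v} = Pair r ` {u. u < n - r \<and> a (r, u) = v}"
    by (auto simp: tri_def)
  also have "card \<dots> = card {u. u < n - r \<and> a (r, u) = v}"
    by (rule card_image) (auto intro: inj_onI)
  also have "\<dots> = of_bool (v \<in> (\<lambda>u. a (r, u)) ` {..<n - r})"
  proof (cases "v \<in> (\<lambda>u. a (r, u)) ` {..<n - r}")
    case True
    then obtain u where "u < n - r" "a (r, u) = v" by auto
    then have "{u. u < n - r \<and> a (r, u) = v} = {u}"
      using assms(1) by (auto simp: inj_on_def)
    with True show ?thesis by simp
  next
    case False
    then have *: "{u. u < n - r \<and> a (r, u) = v} = {}" by auto
    show ?thesis unfolding * using False by simp
  qed
  finally show ?thesis .
qed

text \<open>From \<open>r\<close> to \<open>Suc r\<close> only row \<open>Suc r\<close> changes its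
  contribution: an entry \<open>x\<close> of it is counted at the site \<open>x\<close> before and
  at \<open>x - 1\<close> after. This is the hypothesis of \<open>energy_step\<close>.\<close>

lemma rate_step:
  assumes "inj_on (\<lambda>u. a (Suc r, u)) {..<n - Suc r}" "Suc r < n"
  defines "A \<equiv> (\<lambda>u. a (Suc r, u)) ` {..<n - Suc r}"
  shows "rate n a r v + of_bool (Suc v \<in> A) = rate n a (Suc r) v + of_bool (v \<in> A)"
proof -
  have "(\<Sum>p\<in>tri n. (of_bool (r < fst p \<and> a p = v) + of_bool (fst p \<le> r \<and> a p = Suc v))
        + of_bool (fst p = Suc r \<and> a p = Suc v) :: nat)
      = (\<Sum>p\<in>tri n. (of_bool (Suc r < fst p \<and> a p = v) + of_bool (fst p \<le> Suc r \<and> a p = Suc v))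
        + of_bool (fst p = Suc r \<and> a p = v))"
    by (rule sum.cong[OF refl]) (auto simp: of_bool_def)
  then show ?thesis
    unfolding rate_def A_def sum_row_indicator[OF assms(1,2), symmetric] sum.distrib by simp
qed


text \<open>The entry \<open>a (r + 1, u)\<close> minus 1 is the value of the corresponding undecorated entry in the tuple of
  order \<open>m\<close>.\<close>

lemma rate_multiset:
  assumes a: "a \<in> monotone_triangles (Suc m)"
  shows "(\<Sum>(r, u)\<in>tri (Suc m). {#rate (Suc m) a r (a (r, u))#})
    = mset_set {..<Suc m} + (\<Sum>(r, u)\<in>tri m. {#rate (Suc m) a r (a (Suc r, u) - 1)#})"
proof -
  define n where "n = Suc m"
  define f where "f = rate n a"
  define A where "A r = (\<lambda>u. a (r, u)) ` {..<n - r}" for r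
  define E where "E r = (\<Sum>v<2 * n. mset_set {..<f r v})" for r
  \<comment> \<open>The rows above index 0 enter both ends of the telescope through
    \<open>\<tau>\<close> alone: \<open>f 0\<close> uses \<open>\<tau> v\<close> and
    \<open>f m\<close> uses \<open>\<tau> (Suc v)\<close>. \<open>g\<close> is the common profile to
    which both ends are completed.\<close>
  define \<tau> where "\<tau> v = (\<Sum>p\<in>tri n. of_bool (0 < fst p \<and> a p = v) :: nat)" for v
  define g where "g v = mset_set {..<\<tau> v + (n - v)}" for v
  note a = a[folded n_def]
  have inj: "inj_on (\<lambda>u. a (r, u)) {..<n - r}" for r
    by (rule triangle_row_inj[OF a])
  have sum_A: "(\<Sum>v\<in>A r. h v) = (\<Sum>u<n - r. h (a (r, u)))" for h :: "nat \<Rightarrow> nat multiset" and r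
    unfolding A_def by (subst sum.reindex[OF inj]) simp
  have step: "E r + (\<Sum>u<m - r. {#f r (a (Suc r, u) - 1)#})
      = E (Suc r) + (\<Sum>u<m - r. {#f (Suc r) (a (Suc r, u))#})" if "r < m" for r
  proof -
    have "A (Suc r) \<subseteq> {0<..<2 * n}"
    proof
      fix v assume "v \<in> A (Suc r)"
      then obtain u where "u < n - Suc r" and v: "v = a (Suc r, u)"
        unfolding A_def by auto
      then have u: "Suc r + u < n" by simp
      with triangle_bound[OF a u] triangle_pos[OF a u] v show "v \<in> {0<..<2 * n}"
        by auto
    qed
    moreover have "f r v + of_bool (Suc v \<in> A (Suc r)) = f (Suc r) v + of_bool (v \<in> A (Suc r))" for v
      unfolding f_def A_def by (rule rate_step[OF inj]) (use that in \<open>simp add: n_def\<close>)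
    ultimately have "E r + (\<Sum>v\<in>A (Suc r). {#f r (v - 1)#})
        = E (Suc r) + (\<Sum>v\<in>A (Suc r). {#f (Suc r) v#})"
      unfolding E_def by (intro energy_step) auto
    then show ?thesis
      unfolding sum_A by (simp add: n_def)
  qed
  have tele: "E 0 + (\<Sum>r<k. \<Sum>u<m - r. {#f r (a (Suc r, u) - 1)#})
      = E k + (\<Sum>r<k. \<Sum>u<m - r. {#f (Suc r) (a (Suc r, u))#})" if "k \<le> m" for k
    using that
  proof (induction k)
    case (Suc k)
    then show ?case
      using step[of k] by (simp add: add.assoc[symmetric])
  qed simp
  have row0: "a (0, u) = m - u" if "u \<le> m" for u
    using a that by (simp add: monotone_triangles_def n_def)
  have A0: "A 0 = {..m}"
  proof
    show "{..m} \<subseteq> A 0"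
    proof
      fix v assume "v \<in> {..m}"
      then have "v = a (0, m - v)" "m - v \<in> {..<n - 0}"
        using row0[of "m - v"] by (auto simp: n_def)
      then show "v \<in> A 0" unfolding A_def by blast
    qed
  qed (use row0 in \<open>auto simp: A_def n_def\<close>)
  have ind0: "(\<Sum>p\<in>tri n. of_bool (fst p = 0 \<and> a p = v)) = (of_bool (v \<le> m) :: nat)" for v
    using sum_row_indicator[OF inj, of 0 v] A0 by (simp add: A_def n_def)
  have f0: "f 0 v = \<tau> v + (m - v)" for v
    using ind0[of "Suc v"] by (auto simp: f_def rate_def \<tau>_def sum.distrib n_def)
  have fm: "f m v = \<tau> (Suc v) + (m - v)" for v
  proof -
    have "(\<Sum>p\<in>tri n. of_bool (m < fst p \<and> a p = v) + of_bool (fst p \<le> m \<and> a p = Suc v) :: nat)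
        = (\<Sum>p\<in>tri n. of_bool (0 < fst p \<and> a p = Suc v) + of_bool (fst p = 0 \<and> a p = Suc v))"
      by (rule sum.cong) (auto simp: n_def tri_def)
    then show ?thesis
      using ind0[of "Suc v"] by (auto simp: f_def rate_def \<tau>_def sum.distrib n_def)
  qed
  have tau_zero: "\<tau> 0 = 0"
    unfolding \<tau>_def
  proof (rule sum.neutral, rule ballI)
    fix p assume "p \<in> tri n"
    then show "of_bool (0 < fst p \<and> a p = 0) = (0 :: nat)"
      using triangle_pos[OF a, of "fst p - 1" "snd p"] by (cases p; cases "fst p") auto
  qed
  have tau_large: "\<tau> (2 * n) = 0"
    unfolding \<tau>_def
  proof (rule sum.neutral, rule ballI)
    fix p assume "p \<in> tri n"
    then show "of_bool (0 < fst p \<and> a p = 2 * n) = (0 :: nat)"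
      using triangle_bound[OF a, of "fst p" "snd p"] by (cases p) auto
  qed
  \<comment> \<open>Row 0 consists of \<open>0, \<dots>, m\<close>. Adding the exponent
    \<open>f 0 v\<close> at just these sites turns \<open>m - v\<close> into \<open>n - v\<close>;
    at later sites both differences are 0.\<close>
  have E0: "E 0 + (\<Sum>v\<in>A 0. {#f 0 v#}) = (\<Sum>v<2 * n. g v)"
  proof -
    have "(\<Sum>v\<in>A 0. {#f 0 v#}) = (\<Sum>v<2 * n. if v \<in> A 0 then {#f 0 v#} else {#})"
      by (rule sum_if_mem[symmetric]) (auto simp: A0 n_def)
    moreover have "mset_set {..<f 0 v} + (if v \<in> A 0 then {#f 0 v#} else {#}) = g v" for v
      by (auto simp: A0 g_def f0 n_def Suc_diff_le lessThan_Suc)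
    ultimately show ?thesis
      by (simp add: E_def sum.distrib[symmetric])
  qed
  \<comment> \<open>The profile of \<open>f m\<close> is that of \<open>g\<close> moved by one site.
    The site 0 left out carries \<open>{..<n}\<close>, because \<open>\<tau> 0 = 0\<close>, and the
    extra site \<open>2 * n\<close> is empty. This block \<open>{..<n}\<close> is the source of the
    exponents \<open>0, \<dots>, m\<close>.\<close>
  have Em: "E m + mset_set {..<n} = (\<Sum>v<2 * n. g v)"
  proof -
    have "E m + mset_set {..<n} = (\<Sum>v<2 * n. g (Suc v)) + g 0"
      by (simp add: E_def g_def fm tau_zero n_def)
    also have "\<dots> = (\<Sum>v<Suc (2 * n). g v)"
      by (simp only: sum.lessThan_Suc_shift add.commute)
    also have "\<dots> = (\<Sum>v<2 * n. g v)"
      by (simp add: g_def tau_large)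
    finally show ?thesis .
  qed
  have lhs: "(\<Sum>(r, u)\<in>tri n. {#f r (a (r, u))#})
      = (\<Sum>v\<in>A 0. {#f 0 v#}) + (\<Sum>r<m. \<Sum>u<m - r. {#f (Suc r) (a (Suc r, u))#})"
    unfolding sum_A n_def sum_tri_Suc by (simp add: sum_tri lessThan_Suc_atMost)
  \<comment> \<open>\<open>E m\<close> is kept on both sides and cancelled at the end, as multisets
    form a cancellative monoid.\<close>
  have "E m + (\<Sum>(r, u)\<in>tri n. {#f r (a (r, u))#})
      = (\<Sum>v\<in>A 0. {#f 0 v#}) + (E 0 + (\<Sum>r<m. \<Sum>u<m - r. {#f r (a (Suc r, u) - 1)#}))"
    unfolding lhs tele[OF order.refl] by (simp add: add.left_commute)
  also have "\<dots> = E m + (mset_set {..<n} + (\<Sum>(r, u)\<in>tri m. {#f r (a (Suc r, u) - 1)#}))"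
    using E0 Em by (simp add: sum_tri add.assoc[symmetric] add.commute)
  finally show ?thesis
    by (simp add: f_def n_def)
qed

section \<open>Shuffling\<close>

definition forced_up :: "nat \<Rightarrow> (nat \<times> nat \<Rightarrow> nat) \<Rightarrow> (nat \<times> nat) set" where
  "forced_up n a = {(r, u). r + Suc u < n \<and> a (Suc r, u) = Suc (a (r, u))}"

text \<open>The forced decorations of \<open>(a, U)\<close> itself sit at the \<open>shift\<close> of this set, those of the tuple whose
  \<open>b\<close> is given by \<open>a\<close> sit at the set itself.\<close>

definition forced_down :: "nat \<Rightarrow> (nat \<times> nat \<Rightarrow> nat) \<Rightarrow> (nat \<times> nat) set" where
  "forced_down n a = {(r, u). r + Suc u < n \<and> a (Suc r, u) = Suc (a (r, Suc u))}"

definition shift :: "nat \<times> nat \<Rightarrow> nat \<times> nat" where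
  "shift = (\<lambda>(r, u). (r, Suc u))"

lemma mem_shift_forced_down:
  "(r, v) \<in> shift ` forced_down n a \<longleftrightarrow>
    (\<exists>u. v = Suc u \<and> r + v < n \<and> a (Suc r, u) = Suc (a (r, v)))"
  by (auto simp: shift_def forced_down_def image_iff)

lemma inj_shift: "inj_on shift A"
  by (auto simp: shift_def inj_on_def)

text \<open>Rows are strictly decreasing since an entry of the preceding row separates neighbours:
  \<open>a (Suc s, Suc u) \<le> raised a U (s, Suc u) < a (Suc s, u)\<close>.\<close>

lemma config_triangle:
  assumes "(a, U) \<in> configs n"
  shows "a \<in> monotone_triangles n"
proof -
  have strict: "a (r, Suc u) < a (r, u)" if "r + Suc u < n" for r u
  proof (cases r)
    case 0
    then show ?thesis using assms that by (simp add: configs_def)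
  next
    case (Suc s)
    then have "a (Suc s, Suc u) \<le> raised a U (s, Suc u)" "raised a U (s, Suc u) < a (Suc s, u)"
      using assms that by (auto simp: configs_def)
    then show ?thesis using Suc by simp
  qed
  have "a (r, Suc u) < a (Suc r, u) \<and> a (Suc r, u) \<le> Suc (a (r, u))" if "r + Suc u < n" for r u
  proof -
    have "raised a U (r, Suc u) < a (Suc r, u) \<and> a (Suc r, u) \<le> raised a U (r, u)"
      using assms that by (simp add: configs_def)
    then show ?thesis by (auto simp: raised_def of_bool_def split: if_splits)
  qed
  then show ?thesis
    using assms strict unfolding monotone_triangles_def configs_def by blast
qed

text \<open>Each interlacing inequality involves \<open>U\<close> through one entry only. Given the
  triangle inequalities, it either holds automatically or decides whether that entry is in
  \<open>U\<close>. Hence the admissible \<open>U\<close> form a Boolean interval.\<close>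

lemma configs_fibre:
  "(a, U) \<in> configs n \<longleftrightarrow> a \<in> monotone_triangles n \<and> forced_up n a \<subseteq> U \<and>
    U \<subseteq> tri n - shift ` forced_down n a"
proof (intro iffI conjI)
  assume c: "(a, U) \<in> configs n"
  then show "a \<in> monotone_triangles n"
    by (rule config_triangle)
  have ineq: "raised a U (r, Suc u) < a (Suc r, u) \<and> a (Suc r, u) \<le> raised a U (r, u)"
    if "r + Suc u < n" for r u
    using c that by (simp add: configs_def)
  show "forced_up n a \<subseteq> U"
    using ineq by (fastforce simp: forced_up_def raised_def of_bool_def split: if_splits)
  show "U \<subseteq> tri n - shift ` forced_down n a"
  proof
    fix p assume p: "p \<in> U"
    obtain r v where rv: "p = (r, v)" by (cases p)
    have "p \<in> tri n" using c p by (auto simp: configs_def)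
    moreover have "p \<notin> shift ` forced_down n a"
    proof
      assume "p \<in> shift ` forced_down n a"
      then obtain u where "v = Suc u" "r + v < n" "a (Suc r, u) = Suc (a (r, v))"
        unfolding rv mem_shift_forced_down by blast
      then show False using ineq[of r u] p by (simp add: raised_def rv)
    qed
    ultimately show "p \<in> tri n - shift ` forced_down n a" by blast
  qed
next
  assume asm: "a \<in> monotone_triangles n \<and> forced_up n a \<subseteq> U \<and> U \<subseteq> tri n - shift ` forced_down n a"
  have "raised a U (r, Suc u) < a (Suc r, u) \<and> a (Suc r, u) \<le> raised a U (r, u)"
    if ru: "r + Suc u < n" for r u
  proof
    have t: "a (r, Suc u) < a (Suc r, u)" "a (Suc r, u) \<le> Suc (a (r, u))"
      using asm ru by (auto simp: monotone_triangles_def)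
    show "raised a U (r, Suc u) < a (Suc r, u)"
    proof (cases "(r, Suc u) \<in> U")
      case True
      then have "(r, Suc u) \<notin> shift ` forced_down n a" using asm by blast
      then show ?thesis using t ru unfolding mem_shift_forced_down by (simp add: raised_def True)
    qed (use t in \<open>simp add: raised_def\<close>)
    show "a (Suc r, u) \<le> raised a U (r, u)"
    proof (cases "(r, u) \<in> U")
      case False
      then have "(r, u) \<notin> forced_up n a" using asm by blast
      then show ?thesis using t ru by (simp add: raised_def False forced_up_def)
    qed (use t in \<open>simp add: raised_def\<close>)
  qed
  moreover have "U \<subseteq> tri n" using asm by blast
  ultimately show "(a, U) \<in> configs n"
    using asm unfolding monotone_triangles_def configs_def by blast
qed

text \<open>A common element would produce two equal entries within a row: in row
  \<open>Suc r\<close> for the first claim, in row \<open>r\<close> for the second.\<close>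

lemma forced_disjoint:
  assumes "a \<in> monotone_triangles n"
  shows "forced_up n a \<inter> shift ` forced_down n a = {}" "forced_up n a \<inter> forced_down n a = {}"
proof -
  have strict: "a (r, Suc u) < a (r, u)" if "r + Suc u < n" for r u
    using assms that by (simp add: monotone_triangles_def)
  have "p \<notin> shift ` forced_down n a" if p: "p \<in> forced_up n a" for p
  proof
    assume s: "p \<in> shift ` forced_down n a"
    obtain r v where rv: "p = (r, v)" by (cases p)
    then obtain u where u: "v = Suc u" "r + v < n" "a (Suc r, u) = Suc (a (r, v))"
      using s unfolding rv mem_shift_forced_down by blast
    have "r + Suc v < n" "a (Suc r, v) = Suc (a (r, v))"
      using p by (auto simp: forced_up_def rv)
    then show False using strict[of "Suc r" u] u by simp
  qed
  then show "forced_up n a \<inter> shift ` forced_down n a = {}" by blast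
  show "forced_up n a \<inter> forced_down n a = {}"
    using strict by (fastforce simp: forced_up_def forced_down_def)
qed

lemma forced_subset:
  "forced_up n a \<subseteq> tri (n - 1)" "forced_down n a \<subseteq> tri (n - 1)"
  "forced_up n a \<subseteq> tri n" "shift ` forced_down n a \<subseteq> tri n"
  by (auto simp: forced_up_def forced_down_def shift_def tri_def)

text \<open>Removing \<open>L\<close> from \<open>U\<close> leaves an arbitrary subset of the free
  elements \<open>I - L - R\<close>, and the sum over these subsets is an expanded product.\<close>

lemma sum_between_prod:
  fixes g h :: "'b \<Rightarrow> 'a :: comm_ring_1"
  assumes I: "finite I" and L: "L \<subseteq> I" and R: "R \<subseteq> I" and LR: "L \<inter> R = {}"
  shows "(\<Sum>U\<in>{U. L \<subseteq> U \<and> U \<subseteq> I - R}. (\<Prod>x\<in>I - U. h x) * (\<Prod>x\<in>U. g x))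
    = (\<Prod>x\<in>R. h x) * (\<Prod>x\<in>L. g x) * (\<Prod>x\<in>I - L - R. h x + g x)"
proof -
  let ?J = "I - L - R"
  have fin: "finite L" "finite R" using assms finite_subset by blast+
  have "(\<Sum>U\<in>{U. L \<subseteq> U \<and> U \<subseteq> I - R}. (\<Prod>x\<in>I - U. h x) * (\<Prod>x\<in>U. g x))
      = (\<Sum>V\<in>Pow ?J. (\<Prod>x\<in>R. h x) * (\<Prod>x\<in>L. g x) * ((\<Prod>x\<in>V. g x) * (\<Prod>x\<in>?J - V. h x)))"
  proof (rule sum.reindex_bij_witness[of _ "\<lambda>V. V \<union> L" "\<lambda>U. U - L"])
    fix U assume U: "U \<in> {U. L \<subseteq> U \<and> U \<subseteq> I - R}"
    then have fU: "finite U" using I finite_subset by blast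
    have "(\<Prod>x\<in>U. g x) = (\<Prod>x\<in>L. g x) * (\<Prod>x\<in>U - L. g x)"
      using U by (subst prod.subset_diff[OF _ fU, of L]) (auto simp: mult.commute)
    moreover have "I - U = R \<union> (?J - (U - L))" "R \<inter> (?J - (U - L)) = {}"
      using U R LR by auto
    then have "(\<Prod>x\<in>I - U. h x) = (\<Prod>x\<in>R. h x) * (\<Prod>x\<in>?J - (U - L). h x)"
      using I fin by (simp add: prod.union_disjoint)
    ultimately show "(\<Prod>x\<in>R. h x) * (\<Prod>x\<in>L. g x) * ((\<Prod>x\<in>U - L. g x) * (\<Prod>x\<in>?J - (U - L). h x))
        = (\<Prod>x\<in>I - U. h x) * (\<Prod>x\<in>U. g x)"
      by (simp add: mult_ac)
  qed (use L LR in auto)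
  also have "\<dots> = (\<Prod>x\<in>R. h x) * (\<Prod>x\<in>L. g x) * (\<Prod>x\<in>?J. g x + h x)"
    using I by (simp add: sum_distrib_left[symmetric] prod_add)
  finally show ?thesis by (simp add: add.commute)
qed

text \<open>The raised values, increased by 1, are placed under a new row
  \<open>m, \<dots>, 0\<close>. The increase makes them interlace with it, as
  \<open>raised a U (0, u)\<close> is \<open>m - 1 - u\<close> or \<open>m - u\<close>. For given
  \<open>U\<close>, \<open>drop_row\<close> undoes this.\<close>

definition lift :: "nat \<Rightarrow> (nat \<times> nat \<Rightarrow> nat) \<Rightarrow> (nat \<times> nat) set \<Rightarrow> nat \<times> nat \<Rightarrow> nat" where
  "lift m a U = (\<lambda>(r, u). if m < r + u then 0 else if r = 0 then m - u else Suc (raised a U (r - 1, u)))"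

definition drop_row :: "(nat \<times> nat \<Rightarrow> nat) \<Rightarrow> (nat \<times> nat) set \<Rightarrow> nat \<times> nat \<Rightarrow> nat" where
  "drop_row c U = (\<lambda>(r, u). c (Suc r, u) - 1 - of_bool ((r, u) \<in> U))"

lemma lift_0 [simp]: "lift m a U (0, u) = m - u"
  by (simp add: lift_def)

lemma lift_Suc: "r + u < m \<Longrightarrow> lift m a U (Suc r, u) = Suc (raised a U (r, u))"
  by (simp add: lift_def)

text \<open>Raising moves an entry by at most 1, so the inequalities between \<open>a\<close> and
  \<open>raised a U\<close> become those of a monotone triangle. Where one of the bounds on the
  lifted entry is attained, it reveals whether the entry was raised; so \<open>U\<close> again lies
  in a Boolean interval once the lift is fixed.\<close>

lemma lift_triangle:
  assumes c: "(a, U) \<in> configs m"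
  shows "lift m a U \<in> monotone_triangles (Suc m)"
    and "forced_up (Suc m) (lift m a U) \<subseteq> U"
    and "U \<subseteq> tri m - forced_down (Suc m) (lift m a U)"
    and "drop_row (lift m a U) U = a"
proof -
  let ?b = "raised a U" and ?c = "lift m a U"
  have U: "U \<subseteq> tri m" using c by (simp add: configs_def)
  have out: "a p = 0" if "p \<notin> tri m" for p using c that unfolding configs_def by blast
  have ineq: "?b (r, Suc u) < a (Suc r, u) \<and> a (Suc r, u) \<le> ?b (r, u)" if "r + Suc u < m" for r u
    using c that by (simp add: configs_def)
  have row0: "a (0, u) = m - 1 - u" if "u < m" for u
    using c that by (simp add: configs_def)
  have b: "a p \<le> ?b p" "?b p \<le> Suc (a p)" for p by (auto simp: raised_def)
  have "?c (r, Suc u) < ?c (r, u) \<and> ?c (r, Suc u) < ?c (Suc r, u) \<and> ?c (Suc r, u) \<le> Suc (?c (r, u))"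
    if ru: "r + Suc u < Suc m" for r u
  proof (cases r)
    case 0
    then show ?thesis using ru row0[of u] b[of "(0, u)"] by (simp add: lift_Suc) linarith
  next
    case (Suc s)
    then show ?thesis using ru ineq[of s u] b[of "(Suc s, u)"] by (simp add: lift_Suc)
  qed
  moreover have "?c p = 0" if "p \<notin> tri (Suc m)" for p
    using that by (cases p) (simp add: lift_def)
  moreover have "\<forall>u<Suc m. ?c (0, u) = Suc m - 1 - u" by simp
  ultimately show "?c \<in> monotone_triangles (Suc m)"
    unfolding monotone_triangles_def by blast
  show "forced_up (Suc m) ?c \<subseteq> U"
  proof
    fix p assume p: "p \<in> forced_up (Suc m) ?c"
    obtain r u where [simp]: "p = (r, u)" by (cases p)
    have ru: "r + u < m" and eq: "?b (r, u) = ?c (r, u)"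
      using p by (auto simp: forced_up_def lift_Suc)
    show "p \<in> U"
    proof (cases r)
      case 0
      then show ?thesis using ru eq row0[of u] by (auto simp: raised_def of_bool_def split: if_splits)
    next
      case (Suc s)
      then have "?b (Suc s, u) = Suc (?b (s, u))" using eq ru by (simp add: lift_Suc)
      then show ?thesis using ineq[of s u] ru Suc by (auto simp: raised_def of_bool_def split: if_splits)
    qed
  qed
  have "p \<notin> forced_down (Suc m) ?c" if "p \<in> U" for p
  proof
    assume p: "p \<in> forced_down (Suc m) ?c"
    obtain r u where [simp]: "p = (r, u)" by (cases p)
    have ru: "r + u < m" and eq: "?b (r, u) = ?c (r, Suc u)"
      using p by (auto simp: forced_down_def lift_Suc)
    have bp: "?b (r, u) = Suc (a (r, u))" using that by (simp add: raised_def)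
    show False
    proof (cases r)
      case 0
      then show ?thesis using ru eq row0[of u] bp by simp
    next
      case (Suc s)
      then have "?b (Suc s, u) = Suc (?b (s, Suc u))" using eq ru by (simp add: lift_Suc)
      then show ?thesis using ineq[of s u] ru Suc bp by simp
    qed
  qed
  then show "U \<subseteq> tri m - forced_down (Suc m) ?c" using U by blast
  show "drop_row ?c U = a"
  proof
    fix p :: "nat \<times> nat"
    obtain r u where [simp]: "p = (r, u)" by (cases p)
    show "drop_row ?c U p = a p"
    proof (cases "r + u < m")
      case True
      then show ?thesis by (simp add: drop_row_def lift_Suc raised_def)
    next
      case False
      then show ?thesis using out[of p] by (simp add: drop_row_def lift_def)
    qed
  qed
qed

text \<open>The converse of \<open>lift_triangle\<close>: every \<open>U\<close> in the interval
  over \<open>c\<close> occurs, so lifting is a bijection onto pairs of a triangle and such a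
  set.\<close>

lemma drop_row_config:
  assumes c: "c \<in> monotone_triangles (Suc m)"
    and up: "forced_up (Suc m) c \<subseteq> U" and down: "U \<subseteq> tri m - forced_down (Suc m) c"
  shows "(drop_row c U, U) \<in> configs m" "lift m (drop_row c U) U = c"
proof -
  let ?a = "drop_row c U"
  have c_ineq: "c (r, Suc u) < c (Suc r, u)" "c (Suc r, u) \<le> Suc (c (r, u))" "c (r, Suc u) < c (r, u)"
    if "r + u < m" for r u
    using c that by (auto simp: monotone_triangles_def)
  have out: "c p = 0" if "p \<notin> tri (Suc m)" for p
    using c that unfolding monotone_triangles_def by blast
  have row0: "c (0, u) = m - u" if "u \<le> m" for u
    using c that by (simp add: monotone_triangles_def)
  \<comment> \<open>The bounds on \<open>c (Suc r, u)\<close>, sharpened by membership in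
    \<open>U\<close>: the equality cases to be excluded are those of \<open>forced_down\<close> and
    \<open>forced_up\<close>. The first bound also shows that the subtractions in
    \<open>drop_row\<close> do not truncate.\<close>
  have key: "c (r, Suc u) + of_bool ((r, u) \<in> U) < c (Suc r, u)"
    "c (Suc r, u) \<le> c (r, u) + of_bool ((r, u) \<in> U)" if ru: "r + u < m" for r u
  proof -
    show "c (r, Suc u) + of_bool ((r, u) \<in> U) < c (Suc r, u)"
    proof (cases "(r, u) \<in> U")
      case True
      then have "(r, u) \<notin> forced_down (Suc m) c" using down by blast
      then show ?thesis using c_ineq[OF ru] ru True by (simp add: forced_down_def)
    qed (use c_ineq[OF ru] in simp)
    show "c (Suc r, u) \<le> c (r, u) + of_bool ((r, u) \<in> U)"
    proof (cases "(r, u) \<in> U")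
      case False
      then have "(r, u) \<notin> forced_up (Suc m) c" using up by blast
      then show ?thesis using c_ineq[OF ru] ru False by (simp add: forced_up_def)
    qed (use c_ineq[OF ru] in simp)
  qed
  have a: "?a (r, u) = c (Suc r, u) - 1 - of_bool ((r, u) \<in> U)" for r u
    by (simp add: drop_row_def)
  have b: "raised ?a U (r, u) = c (Suc r, u) - 1" if "r + u < m" for r u
    using key(1)[OF that] by (auto simp: raised_def a of_bool_def)
  have "raised ?a U (r, Suc u) < ?a (Suc r, u) \<and> ?a (Suc r, u) \<le> raised ?a U (r, u)"
    if ru: "r + Suc u < m" for r u
  proof -
    have "c (Suc r, Suc u) + of_bool ((Suc r, u) \<in> U) < c (Suc (Suc r), u)"
      "c (Suc (Suc r), u) \<le> c (Suc r, u) + of_bool ((Suc r, u) \<in> U)" "0 < c (Suc r, Suc u)"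
      using key[of "Suc r" u] key(1)[of r "Suc u"] ru by auto
    then show ?thesis
      using ru unfolding a by (auto simp: b of_bool_def split: if_splits)
  qed
  moreover have "?a (0, u) = m - 1 - u" if u: "u < m" for u
    using key[of 0 u] row0[of u] row0[of "Suc u"] u by (simp add: a)
  moreover have "?a p = 0" if "p \<notin> tri m" for p
    using that out[of "(Suc (fst p), snd p)"] by (cases p) (simp add: a)
  moreover have "U \<subseteq> tri m" using down by blast
  ultimately show "(?a, U) \<in> configs m"
    unfolding configs_def by blast
  show "lift m ?a U = c"
  proof
    fix p :: "nat \<times> nat"
    obtain r u where p: "p = (r, u)" by (cases p)
    show "lift m ?a U p = c p"
    proof (cases "r + u \<le> m")
      case True
      show ?thesis
      proof (cases r)
        case 0
        then show ?thesis using True row0[of u] by (simp add: p)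
      next
        case (Suc s)
        then show ?thesis using True b[of s u] key(1)[of s u] by (simp add: p lift_Suc)
      qed
    next
      case False
      then show ?thesis using out[of p] by (simp add: p lift_def)
    qed
  qed
qed

section \<open>Exponents of \<open>t\<close> under lifting\<close>

lemma triangle_eqI:
  assumes "a \<in> monotone_triangles n" "p \<in> tri n" "s \<in> tri n" "fst p = fst s" "a p = a s"
  shows "p = s"
proof -
  obtain r u v where p: "p = (r, u)" and s: "s = (r, v)"
    using assms(4) by (cases p; cases s) auto
  have "u = v"
    by (rule inj_onD[OF triangle_row_inj[OF assms(1), of r]])
      (use assms(2,3,5) in \<open>simp_all add: p s less_diff_conv add.commute\<close>)
  then show ?thesis by (simp add: p s)
qed

text \<open>Pairs with exactly one entry in \<open>U\<close> agree on both sides; pairs inside \<open>U\<close> are exchanged.\<close>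

lemma lift_rate_pairs:
  assumes c: "(a, U) \<in> configs m"
  defines "b \<equiv> raised a U"
  shows "(\<Sum>p\<in>U. \<Sum>s\<in>tri m. of_bool (fst p < fst s \<and> a s = a p) + of_bool (fst s \<le> fst p \<and> a s = Suc (a p)))
    = (\<Sum>p\<in>U. \<Sum>s\<in>tri m. of_bool (fst p \<le> fst s \<and> b s = a p) + of_bool (fst s < fst p \<and> b s = Suc (a p)) :: nat)"
    (is "(\<Sum>p\<in>U. \<Sum>s\<in>tri m. ?A p s) = (\<Sum>p\<in>U. \<Sum>s\<in>tri m. ?B p s)")
proof -
  have U: "U \<subseteq> tri m" using c by (simp add: configs_def)
  have inj_a: "p = s" if "p \<in> tri m" "s \<in> tri m" "fst p = fst s" "a p = a s" for p s
    using triangle_eqI[OF config_triangle[OF c]] that by blast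
  \<comment> \<open>The rows of \<open>b\<close>, increased by 1, are rows of the lift, which is a
    monotone triangle.\<close>
  have inj_b: "p = s" if "p \<in> tri m" "s \<in> tri m" "fst p = fst s" "b p = b s" for p s
  proof -
    have "(Suc (fst p), snd p) = (Suc (fst s), snd s)"
      by (rule triangle_eqI[OF lift_triangle(1)[OF c]])
        (use that in \<open>cases p; cases s; simp add: lift_Suc b_def\<close>)+
    then show ?thesis by (simp add: prod_eq_iff)
  qed
  have split: "(\<Sum>p\<in>U. \<Sum>s\<in>tri m. f p s) = (\<Sum>p\<in>U. \<Sum>s\<in>tri m - U. f p s) + (\<Sum>p\<in>U. \<Sum>s\<in>U. f p s)"
    for f :: "nat \<times> nat \<Rightarrow> nat \<times> nat \<Rightarrow> nat"
    unfolding sum.distrib[symmetric] by (intro sum.cong refl sum.subset_diff[OF U]) simp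
  have "?A p s = ?B p s" if p: "p \<in> U" and s: "s \<in> tri m - U" for p s
  proof -
    have bs: "b s = a s" and bp: "b p = Suc (a p)" using p s by (simp_all add: b_def raised_def)
    have ps: "p \<in> tri m" "s \<in> tri m" "p \<noteq> s" using p s U by blast+
    show ?thesis
    proof (cases "fst p = fst s")
      case True
      \<comment> \<open>Within one row \<open>?A\<close> and \<open>?B\<close> could differ only
        through the ties \<open>a s = Suc (a p)\<close> and \<open>a s = a p\<close>. Distinctness
        in the rows of \<open>b\<close> and of \<open>a\<close> rules these out.\<close>
      then have "a p \<noteq> a s" "b p \<noteq> b s"
        using inj_a[OF ps(1,2)] inj_b[OF ps(1,2)] ps(3) by blast+
      then have "a s \<noteq> a p" "a s \<noteq> Suc (a p)"
        unfolding bs bp by (simp_all only: not_sym)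
      then show ?thesis unfolding bs by simp
    next
      case False
      then have "fst p \<le> fst s \<longleftrightarrow> fst p < fst s" "fst s \<le> fst p \<longleftrightarrow> fst s < fst p"
        by linarith+
      then show ?thesis unfolding bs by simp
    qed
  qed
  then have out: "(\<Sum>p\<in>U. \<Sum>s\<in>tri m - U. ?A p s) = (\<Sum>p\<in>U. \<Sum>s\<in>tri m - U. ?B p s)"
    by (intro sum.cong refl)
  have "?B p s = ?A s p" if "p \<in> U" "s \<in> U" for p s
    using that by (auto simp: b_def raised_def of_bool_def)
  then have "(\<Sum>p\<in>U. \<Sum>s\<in>U. ?B p s) = (\<Sum>p\<in>U. \<Sum>s\<in>U. ?A s p)"
    by (intro sum.cong refl)
  also have "\<dots> = (\<Sum>p\<in>U. \<Sum>s\<in>U. ?A p s)"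
    by (rule sum.swap)
  finally show ?thesis
    unfolding split[of ?A] split[of ?B] out by (rule arg_cong[OF sym])
qed

text \<open>The left side is the exponent of \<open>t\<close> in \<open>weight\<close>. The right
  side is affine in \<open>U\<close> when the lift, instead of \<open>a\<close>, is held
  fixed.\<close>

lemma lift_rate:
  assumes c: "(a, U) \<in> configs m"
  defines "c \<equiv> lift m a U"
  shows "(\<Sum>p\<in>tri m. m - 1 - a p) + (\<Sum>p\<in>U. rate m a (fst p) (a p))
    = (\<Sum>(r, u)\<in>tri m. m - c (Suc r, u))
      + (\<Sum>(r, u)\<in>U. rate (Suc m) c r (c (Suc r, u) - 1))"
proof -
  define b where "b = raised a U"
  have U: "U \<subseteq> tri m" using assms(1) by (simp add: configs_def)
  then have finU: "finite U" by (rule finite_subset) simp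
  have cb: "c (Suc r, u) = Suc (b (r, u))" if "(r, u) \<in> tri m" for r u
    using that by (simp add: c_def b_def lift_Suc)
  \<comment> \<open>Row 0 of the lift contains each value up to \<open>m\<close> once. In
    \<open>new\<close> this turns the truncated summand \<open>m - 2 - a (r, u)\<close> into
    \<open>m - Suc (a (r, u))\<close>.\<close>
  have row0: "(\<Sum>w\<le>m. of_bool (c (0, w) = Suc v)) = (of_bool (Suc v \<le> m) :: nat)" for v
  proof (cases "Suc v \<le> m")
    case True
    then have *: "w \<le> m \<Longrightarrow> c (0, w) = Suc v \<longleftrightarrow> w = m - Suc v" for w
      by (auto simp: c_def)
    have "(\<Sum>w\<le>m. of_bool (c (0, w) = Suc v)) = (\<Sum>w\<le>m. of_bool (w = m - Suc v) :: nat)"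
      by (intro sum.cong refl) (simp add: *)
    also have "\<dots> = 1"
      by (simp add: of_bool_def)
    finally show ?thesis using True by simp
  qed (auto simp: c_def)
  have new: "rate (Suc m) c r (c (Suc r, u) - 1)
      = (\<Sum>s\<in>tri m. of_bool (r \<le> fst s \<and> b s = a (r, u)) + of_bool (fst s < r \<and> b s = Suc (a (r, u))))
        + (m - Suc (a (r, u)))" if ru: "(r, u) \<in> U" for r u
  proof -
    have v: "c (Suc r, u) - 1 = Suc (a (r, u))"
      using cb[of r u] U ru by (auto simp: b_def raised_def)
    have rows: "(\<Sum>(s, w)\<in>tri m. of_bool (r < Suc s \<and> c (Suc s, w) = Suc (a (r, u)))
          + of_bool (Suc s \<le> r \<and> c (Suc s, w) = Suc (Suc (a (r, u)))) :: nat)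
        = (\<Sum>s\<in>tri m. of_bool (r \<le> fst s \<and> b s = a (r, u)) + of_bool (fst s < r \<and> b s = Suc (a (r, u))))"
      by (rule sum.cong) (auto simp: cb less_Suc_eq_le Suc_le_eq)
    show ?thesis
      unfolding v rate_def sum_tri_Suc using rows row0[of "Suc (a (r, u))"]
      by (auto simp: of_bool_def)
  qed
  have "(\<Sum>(r, u)\<in>U. rate (Suc m) c r (c (Suc r, u) - 1))
      = (\<Sum>p\<in>U. \<Sum>s\<in>tri m. of_bool (fst p \<le> fst s \<and> b s = a p) + of_bool (fst s < fst p \<and> b s = Suc (a p)))
        + (\<Sum>p\<in>U. m - Suc (a p))"
    unfolding sum.distrib[symmetric, of _ U] by (rule sum.cong) (auto simp: new simp del: One_nat_def)
  moreover have "(\<Sum>p\<in>U. rate m a (fst p) (a p))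
      = (\<Sum>p\<in>U. \<Sum>s\<in>tri m. of_bool (fst p < fst s \<and> a s = a p) + of_bool (fst s \<le> fst p \<and> a s = Suc (a p)))
        + (\<Sum>p\<in>U. m - 2 - a p)"
    by (simp add: rate_def sum.distrib)
  moreover have "(\<Sum>p\<in>tri m. m - 1 - a p) + (\<Sum>p\<in>U. m - 2 - a p)
      = (\<Sum>(r, u)\<in>tri m. m - c (Suc r, u)) + (\<Sum>p\<in>U. m - Suc (a p))"
  proof -
    have split: "sum f (tri m) = sum f (tri m - U) + sum f U" for f :: "nat \<times> nat \<Rightarrow> nat"
      by (rule sum.subset_diff[OF U]) simp
    have "(\<Sum>(r, u)\<in>tri m. m - c (Suc r, u)) = (\<Sum>p\<in>tri m. m - Suc (b p))"
      by (rule sum.cong) (auto simp: cb)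
    also have "\<dots> = (\<Sum>p\<in>tri m - U. m - 1 - a p) + (\<Sum>p\<in>U. m - 2 - a p)"
      unfolding split by (intro arg_cong2[of _ _ _ _ "(+)"] sum.cong refl) (auto simp: b_def raised_def)
    finally show ?thesis
      unfolding split by simp
  qed
  ultimately show ?thesis
    using lift_rate_pairs[OF assms(1)] unfolding b_def by linarith
qed

section \<open>Powers of \<open>q\<close> and the recursion for the generating function\<close>

lemma card_tri: "card (tri m) = \<Sum>{..m}"
proof -
  have "card (tri m) = (\<Sum>r<m. m - r)"
    by (simp add: tri_Sigma)
  also have "\<dots> = (\<Sum>r\<in>{1..m}. r)"
    by (rule sum.reindex_bij_witness[of _ "\<lambda>r. m - r" "\<lambda>r. m - r"]) auto
  also have "\<dots> = \<Sum>{..m}"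
    by (rule sum.mono_neutral_left) auto
  finally show ?thesis .
qed

lemma sum_diff_atMost: "(\<Sum>u\<le>m. m - u) = \<Sum>{..m}" for m :: nat
  by (rule sum.reindex_bij_witness[of _ "\<lambda>r. m - r" "\<lambda>r. m - r"]) auto

lemma two_sum_atMost: "\<Sum>{..m} + \<Sum>{..m} = m * Suc m" for m :: nat
  by (induction m) auto

text \<open>The new row and the increase of all other entries by 1 contribute
  \<open>m * Suc m / 2\<close> each. The summand \<open>card U\<close> is what replaces
  \<open>w\<close> by \<open>w * q\<close>.\<close>

lemma lift_sum:
  assumes "(a, U) \<in> configs m"
  shows "(\<Sum>p\<in>tri (Suc m). lift m a U p) = m * Suc m + (\<Sum>p\<in>tri m. a p) + card U"
proof -
  have U: "U \<subseteq> tri m" using assms by (simp add: configs_def)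
  have "(\<Sum>p\<in>tri (Suc m). lift m a U p) = \<Sum>{..m} + (\<Sum>p\<in>tri m. Suc (raised a U p))"
    unfolding sum_tri_Suc by (auto simp: sum_diff_atMost lift_Suc intro!: sum.cong)
  also have "(\<Sum>p\<in>tri m. Suc (raised a U p)) = (\<Sum>p\<in>tri m. a p) + card U + card (tri m)"
    using U by (simp add: raised_def sum.distrib sum_Suc Int_absorb1)
  finally show ?thesis
    using two_sum_atMost[of m] by (simp add: card_tri)
qed

text \<open>The auxiliary variable \<open>w\<close> absorbs the factors \<open>q\<close> that undecorated entries gain in the recursion.\<close>

definition weight :: "nat \<Rightarrow> 'a \<Rightarrow> 'a \<Rightarrow> 'a \<Rightarrow> 'a \<Rightarrow> (nat \<times> nat \<Rightarrow> nat) \<Rightarrow> (nat \<times> nat) set \<Rightarrow> 'a :: comm_ring_1" where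
  "weight n z w q t a U = z ^ card (tri n - U) * w ^ card U * q ^ (\<Sum>p\<in>tri n. a p) *
     t ^ ((\<Sum>p\<in>tri n. n - 1 - a p) + (\<Sum>p\<in>U. rate n a (fst p) (a p)))"

definition config_sum :: "nat \<Rightarrow> 'a \<Rightarrow> 'a \<Rightarrow> 'a \<Rightarrow> 'a \<Rightarrow> 'a :: comm_ring_1" where
  "config_sum n z w q t = (\<Sum>(a, U)\<in>configs n. weight n z w q t a U)"

text \<open>A forced undecorated entry satisfies \<open>c (r, u) = c (Suc r, u) - 1\<close>, a
  forced decorated one \<open>c (r, Suc u) = c (Suc r, u) - 1\<close>. So the forced exponents agree
  on both sides and cancel from \<open>rate_multiset\<close>, leaving the surplus
  \<open>0, \<dots>, m\<close>.\<close>

lemma free_rates: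
  fixes z w t :: "'a :: comm_ring_1"
  assumes c: "c \<in> monotone_triangles (Suc m)"
  defines "L \<equiv> forced_up (Suc m) c" and "R \<equiv> forced_down (Suc m) c"
  shows "(\<Prod>p\<in>tri (Suc m) - L - shift ` R. z + w * t ^ rate (Suc m) c (fst p) (c p))
    = (\<Prod>k\<le>m. z + w * t ^ k) *
      (\<Prod>(r, u)\<in>tri m - L - R. z + w * t ^ rate (Suc m) c r (c (Suc r, u) - 1))"
proof -
  define e where "e = (\<lambda>p. rate (Suc m) c (fst p) (c p))"
  define e' where "e' = (\<lambda>(r, u). rate (Suc m) c r (c (Suc r, u) - 1))"
  have sub: "L \<subseteq> tri (Suc m)" "shift ` R \<subseteq> tri (Suc m)" "L \<subseteq> tri m" "R \<subseteq> tri m"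
    using forced_subset[of "Suc m" c] by (simp_all add: L_def R_def)
  have disj: "L \<inter> shift ` R = {}" "L \<inter> R = {}"
    using forced_disjoint[OF c] by (simp_all add: L_def R_def)
  have split: "(\<Sum>p\<in>T. {#f p#}) = (\<Sum>p\<in>A. {#f p#}) + (\<Sum>p\<in>B. {#f p#}) + (\<Sum>p\<in>T - A - B. {#f p#})"
    if "finite T" "A \<subseteq> T" "B \<subseteq> T" "A \<inter> B = {}" for T A B and f :: "nat \<times> nat \<Rightarrow> nat"
  proof -
    have "B \<subseteq> T - A" using that by blast
    then show ?thesis
      using that by (simp add: sum.subset_diff[of A T] sum.subset_diff[of B "T - A"] add_ac)
  qed
  have "(\<Sum>p\<in>L. {#e p#}) = (\<Sum>p\<in>L. {#e' p#})"
    by (rule sum.cong) (auto simp: e_def e'_def L_def forced_up_def)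
  moreover have "(\<Sum>p\<in>shift ` R. {#e p#}) = (\<Sum>p\<in>R. {#e' p#})"
    unfolding sum.reindex[OF inj_shift]
    by (rule sum.cong) (auto simp: e_def e'_def R_def forced_down_def shift_def)
  moreover have "(\<Sum>p\<in>tri (Suc m). {#e p#}) = mset_set {..<Suc m} + (\<Sum>p\<in>tri m. {#e' p#})"
    using rate_multiset[OF c] by (simp add: e_def e'_def case_prod_unfold)
  ultimately have eq: "(\<Sum>p\<in>tri (Suc m) - L - shift ` R. {#e p#})
      = mset_set {..<Suc m} + (\<Sum>p\<in>tri m - L - R. {#e' p#})"
    unfolding split[OF finite_tri sub(1,2) disj(1)] split[OF finite_tri sub(3,4) disj(2)]
    by (simp add: add_ac)
  \<comment> \<open>A product of this form depends only on the multiset of its exponents.\<close>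
  have conv: "(\<Prod>p\<in>S. z + w * t ^ f p) = prod_mset (image_mset (\<lambda>k. z + w * t ^ k) (\<Sum>p\<in>S. {#f p#}))"
    for S and f :: "nat \<times> nat \<Rightarrow> nat"
    unfolding sum_unfold_sum_mset sum_mset_singleton_mset prod_unfold_prod_mset
    by (simp add: multiset.map_comp comp_def)
  have "(\<Prod>p\<in>tri (Suc m) - L - shift ` R. z + w * t ^ e p)
    = (\<Prod>k\<le>m. z + w * t ^ k) * (\<Prod>p\<in>tri m - L - R. z + w * t ^ e' p)"
    unfolding conv eq by (simp add: prod_unfold_prod_mset lessThan_Suc_atMost)
  then show ?thesis
    by (simp add: e_def e'_def case_prod_unfold)
qed

lemma prod_power_rate: "w ^ card U * t ^ (\<Sum>p\<in>U. e p) = (\<Prod>p\<in>U. w * t ^ e p :: 'a :: comm_ring_1)"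
  by (simp add: prod.distrib power_sum)

text \<open>Summation over \<open>U\<close> with the first component \<open>a\<close> fixed.\<close>

lemma config_sum_triangles:
  fixes z w q t :: "'a :: comm_ring_1"
  shows "config_sum n z w q t = (\<Sum>c\<in>monotone_triangles n.
    q ^ (\<Sum>p\<in>tri n. c p) * t ^ (\<Sum>p\<in>tri n. n - 1 - c p) *
    (z ^ card (forced_down n c) * (\<Prod>p\<in>forced_up n c. w * t ^ rate n c (fst p) (c p)) *
      (\<Prod>p\<in>tri n - forced_up n c - shift ` forced_down n c. z + w * t ^ rate n c (fst p) (c p))))"
proof -
  let ?F = "\<lambda>c. {U. forced_up n c \<subseteq> U \<and> U \<subseteq> tri n - shift ` forced_down n c}"
  have conf: "configs n = (SIGMA c:monotone_triangles n. ?F c)"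
  proof (rule set_eqI)
    fix x show "x \<in> configs n \<longleftrightarrow> x \<in> (SIGMA c:monotone_triangles n. ?F c)"
      by (cases x) (simp only: configs_fibre mem_Sigma_iff mem_Collect_eq)
  qed
  have finF: "finite (?F c)" for c
    by (rule finite_subset[of _ "Pow (tri n)"]) auto
  have "config_sum n z w q t = (\<Sum>c\<in>monotone_triangles n. \<Sum>U\<in>?F c. weight n z w q t c U)"
    unfolding config_sum_def conf
    by (rule sum.Sigma[symmetric]) (use finF finite_monotone_triangles in auto)
  also have "\<dots> = (\<Sum>c\<in>monotone_triangles n.
    q ^ (\<Sum>p\<in>tri n. c p) * t ^ (\<Sum>p\<in>tri n. n - 1 - c p) *
    (\<Sum>U\<in>?F c. (\<Prod>p\<in>tri n - U. z) * (\<Prod>p\<in>U. w * t ^ rate n c (fst p) (c p))))"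
    unfolding sum_distrib_left weight_def prod_power_rate[symmetric] prod_constant
    by (intro sum.cong refl) (simp add: power_add mult_ac)
  also have "\<dots> = (\<Sum>c\<in>monotone_triangles n.
    q ^ (\<Sum>p\<in>tri n. c p) * t ^ (\<Sum>p\<in>tri n. n - 1 - c p) *
    ((\<Prod>p\<in>shift ` forced_down n c. z) * (\<Prod>p\<in>forced_up n c. w * t ^ rate n c (fst p) (c p)) *
      (\<Prod>p\<in>tri n - forced_up n c - shift ` forced_down n c. z + w * t ^ rate n c (fst p) (c p))))"
    by (intro sum.cong refl arg_cong2[of _ _ _ _ "(*)"] sum_between_prod forced_subset
        forced_disjoint finite_tri)
  finally show ?thesis
    by (simp add: card_image[OF inj_shift])
qed

text \<open>Summation over \<open>U\<close> with the lift fixed. The result runs over the same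
  triangles as \<open>config_sum_triangles\<close> for order \<open>Suc m\<close>, so the two can be
  compared term by term.\<close>

lemma config_sum_lifted_triangles:
  fixes z w q t :: "'a :: comm_ring_1"
  shows "q ^ (m * Suc m) * config_sum m z (w * q) q t = (\<Sum>c\<in>monotone_triangles (Suc m).
    q ^ (\<Sum>p\<in>tri (Suc m). c p) * t ^ (\<Sum>(r, u)\<in>tri m. m - c (Suc r, u)) *
    (z ^ card (forced_down (Suc m) c) *
      (\<Prod>(r, u)\<in>forced_up (Suc m) c. w * t ^ rate (Suc m) c r (c (Suc r, u) - 1)) *
      (\<Prod>(r, u)\<in>tri m - forced_up (Suc m) c - forced_down (Suc m) c.
        z + w * t ^ rate (Suc m) c r (c (Suc r, u) - 1))))"
proof -
  let ?F = "\<lambda>c. {U. forced_up (Suc m) c \<subseteq> U \<and> U \<subseteq> tri m - forced_down (Suc m) c}"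
  let ?e = "\<lambda>c p. rate (Suc m) c (fst p) (c (Suc (fst p), snd p) - 1)"
  define v where "v c U = q ^ (\<Sum>p\<in>tri (Suc m). c p) * t ^ (\<Sum>(r, u)\<in>tri m. m - c (Suc r, u)) *
      ((\<Prod>p\<in>tri m - U. z) * (\<Prod>p\<in>U. w * t ^ ?e c p))" for c U
  have finF: "finite (?F c)" for c
    by (rule finite_subset[of _ "Pow (tri m)"]) auto
  have "q ^ (m * Suc m) * weight m z (w * q) q t a U = v (lift m a U) U" if aU: "(a, U) \<in> configs m" for a U
    unfolding v_def weight_def lift_sum[OF aU] prod_power_rate[symmetric] prod_constant lift_rate[OF aU]
    by (simp add: power_add power_mult_distrib mult_ac case_prod_unfold)
  then have "q ^ (m * Suc m) * config_sum m z (w * q) q t = (\<Sum>(a, U)\<in>configs m. v (lift m a U) U)"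
    unfolding config_sum_def sum_distrib_left by (intro sum.cong) auto
  also have "\<dots> = (\<Sum>(c, U)\<in>(SIGMA c:monotone_triangles (Suc m). ?F c). v c U)"
    by (rule sum.reindex_bij_witness[of _ "\<lambda>(c, U). (drop_row c U, U)" "\<lambda>(a, U). (lift m a U, U)"])
      (simp_all only: split_paired_all prod.case mem_Sigma_iff mem_Collect_eq lift_triangle
        drop_row_config simp_thms)
  also have "\<dots> = (\<Sum>c\<in>monotone_triangles (Suc m). \<Sum>U\<in>?F c. v c U)"
    by (rule sum.Sigma[symmetric]) (use finF finite_monotone_triangles in auto)
  also have "\<dots> = (\<Sum>c\<in>monotone_triangles (Suc m).
    q ^ (\<Sum>p\<in>tri (Suc m). c p) * t ^ (\<Sum>(r, u)\<in>tri m. m - c (Suc r, u)) *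
    ((\<Prod>p\<in>forced_down (Suc m) c. z) * (\<Prod>p\<in>forced_up (Suc m) c. w * t ^ ?e c p) *
      (\<Prod>p\<in>tri m - forced_up (Suc m) c - forced_down (Suc m) c. z + w * t ^ ?e c p)))"
    unfolding v_def sum_distrib_left[symmetric]
    by (intro sum.cong refl arg_cong2[of _ _ _ _ "(*)"] sum_between_prod forced_disjoint
        finite_tri forced_subset[of "Suc m", simplified])
  finally show ?thesis
    by (simp add: case_prod_unfold)
qed

text \<open>For each triangle the forced factors coincide, \<open>free_rates\<close> compares the
  free ones, and row 0 accounts for the power of \<open>t\<close>.\<close>

lemma config_sum_Suc:
  fixes z w q t :: "'a :: comm_ring_1"
  shows "config_sum (Suc m) z w q t =
    q ^ (m * Suc m) * t ^ \<Sum>{..m} * (\<Prod>k\<le>m. z + w * t ^ k) * config_sum m z (w * q) q t"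
proof -
  have "t ^ (\<Sum>p\<in>tri (Suc m). Suc m - 1 - c p) = t ^ \<Sum>{..m} * t ^ (\<Sum>(r, u)\<in>tri m. m - c (Suc r, u))"
    if c: "c \<in> monotone_triangles (Suc m)" for c
  proof -
    have "(\<Sum>u\<le>m. m - c (0, u)) = \<Sum>{..m}"
      by (rule sum.cong) (use c in \<open>auto simp: monotone_triangles_def\<close>)
    then show ?thesis
      unfolding sum_tri_Suc by (simp add: power_add)
  qed
  moreover have "(\<Prod>p\<in>forced_up (Suc m) c. w * t ^ rate (Suc m) c (fst p) (c p))
      = (\<Prod>(r, u)\<in>forced_up (Suc m) c. w * t ^ rate (Suc m) c r (c (Suc r, u) - 1))" for c
    by (rule prod.cong) (auto simp: forced_up_def)
  ultimately have "config_sum (Suc m) z w q t = t ^ \<Sum>{..m} * (\<Prod>k\<le>m. z + w * t ^ k) *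
      (q ^ (m * Suc m) * config_sum m z (w * q) q t)"
    unfolding config_sum_lifted_triangles config_sum_triangles[of "Suc m"] sum_distrib_left
    by (intro sum.cong refl) (simp only: free_rates mult_ac)
  then show ?thesis by (simp add: mult_ac)
qed

lemma config_sum_0: "config_sum 0 z w q t = 1"
proof -
  have "tri 0 = {}" by (auto simp: tri_def)
  then have "configs 0 = {(\<lambda>_. 0, {})}"
    by (auto simp: configs_def)
  then show ?thesis
    by (simp add: config_sum_def weight_def \<open>tri 0 = {}\<close>)
qed

lemma prod_tri: "prod f (tri n) = (\<Prod>r<n. \<Prod>u<n - r. f (r, u))"
  by (simp add: tri_Sigma prod.Sigma)

lemma prod_tri_Suc:
  "prod f (tri (Suc m)) = (\<Prod>u\<le>m. f (0, u)) * (\<Prod>(r, u)\<in>tri m. f (Suc r, u))"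
  unfolding prod_tri prod.lessThan_Suc_shift by (simp add: lessThan_Suc_atMost)

theorem config_sum_eq:
  fixes z w q t :: "'a :: comm_ring_1"
  shows "config_sum n z w q t = q ^ (\<Sum>k<n. k * Suc k) * t ^ (\<Sum>k<n. \<Sum>{..k}) *
    (\<Prod>(i, j)\<in>tri n. z + w * (q ^ i * t ^ j))"
\<comment> \<open>The recursion replaces \<open>w\<close> by \<open>w * q\<close>; after
  \<open>i\<close> steps its product gives the factors with \<open>q ^ i\<close>.\<close>
proof (induction n arbitrary: w)
  case 0
  have "tri 0 = {}" by (auto simp: tri_def)
  then show ?case by (simp add: config_sum_0)
next
  case (Suc m)
  then show ?case
    unfolding config_sum_Suc prod_tri_Suc
    by (simp add: power_add mult_ac case_prod_unfold)
qed

section \<open>Lattice paths\<close>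

text \<open>A lattice path meets the height \<open>y\<close> in an interval \<open>[l y..r y]\<close> of lattice points.\<close>

definition stair :: "(int \<Rightarrow> int) \<Rightarrow> (int \<Rightarrow> int) \<Rightarrow> int \<Rightarrow> int \<Rightarrow> path" where
  "stair l r s e = concat (map (\<lambda>y. map (\<lambda>x. (x, y)) [l y..r y]) [s..e])"

text \<open>The upward step out of height \<open>y\<close> joins \<open>(r y, y)\<close> to
  \<open>(l (y + 1), y + 1)\<close>; it is north or diagonal.\<close>

definition stair_ok :: "(int \<Rightarrow> int) \<Rightarrow> (int \<Rightarrow> int) \<Rightarrow> int \<Rightarrow> int \<Rightarrow> bool" where
  "stair_ok l r s e \<longleftrightarrow> s \<le> e \<and> (\<forall>y\<in>{s..e}. l y \<le> r y) \<and> (\<forall>y\<in>{s..<e}. l (y + 1) = r y \<or> l (y + 1) = r y + 1)"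

lemma set_stair: "set (stair l r s e) = {(x, y). s \<le> y \<and> y \<le> e \<and> l y \<le> x \<and> x \<le> r y}"
  by (auto simp: stair_def)

lemma stair_cong:
  assumes "\<And>y. s \<le> y \<Longrightarrow> y \<le> e \<Longrightarrow> l y = l' y \<and> r y = r' y"
  shows "stair l r s e = stair l' r' s e"
  unfolding stair_def by (intro arg_cong[of _ _ concat] map_cong refl) (use assms in auto)

lemma stair_rec: "s < e \<Longrightarrow> stair l r s e = map (\<lambda>x. (x, s)) [l s..r s] @ stair l r (s + 1) e"
  unfolding stair_def by (subst upto_rec1) auto

lemma stair_same: "stair l r e e = map (\<lambda>x. (x, e)) [l e..r e]"
  by (simp add: stair_def)

lemma stair_ok_step: "stair_ok l r s e \<Longrightarrow> s < e \<Longrightarrow> stair_ok l r (s + 1) e"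
  by (auto simp: stair_ok_def)

lemma stair_hd:
  assumes "stair_ok l r s e"
  shows "stair l r s e \<noteq> [] \<and> hd (stair l r s e) = (l s, s)"
proof -
  have "s \<le> e" and "l s \<le> r s" using assms by (auto simp: stair_ok_def)
  then have "[l s..r s] = l s # [l s + 1..r s]" by (simp only: upto_rec1)
  then show ?thesis
    using \<open>s \<le> e\<close> by (cases "s = e") (simp_all add: stair_same stair_rec)
qed

lemma stair_induct [consumes 1, case_names same step]:
  assumes "stair_ok l r s e"
    and "\<And>e. stair_ok l r e e \<Longrightarrow> P e e"
    and "\<And>s e. stair_ok l r s e \<Longrightarrow> s < e \<Longrightarrow> P (s + 1) e \<Longrightarrow> P s e"
  shows "P s e"
proof -
  have "s \<le> e" using assms(1) by (simp add: stair_ok_def)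
  then show ?thesis
    using assms(1)
  proof (induction s rule: int_le_induct)
    case base
    then show ?case using assms(2) by blast
  next
    case (step i)
    then show ?case using assms(3)[of "i - 1" e] stair_ok_step[of l r "i - 1" e] by simp
  qed
qed

lemma stair_last: "stair_ok l r s e \<Longrightarrow> last (stair l r s e) = (r e, e)"
proof (induction rule: stair_induct)
  case (same e)
  then show ?case by (auto simp: stair_same stair_ok_def upto_rec2)
next
  case (step s e)
  then show ?case using stair_hd[OF stair_ok_step[OF step(1,2)]] by (simp add: stair_rec)
qed

lemma successively_segment: "successively lattice_step (map (\<lambda>x. (x, y)) [a..b])"
proof (induction "nat (b - a)" arbitrary: a)
  case 0
  then show ?case by (cases "a = b") auto
next
  case (Suc k)
  then have "successively lattice_step (map (\<lambda>x. (x, y)) [a + 1..b])" "a < b" by auto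
  then show ?case
    by (auto simp: upto_rec1[of a b] upto_rec1[of "a + 1" b] lattice_step_def)
qed

lemma stair_is_path:
  assumes "stair_ok l r s e"
  shows "is_lattice_path (l s, s) (r e, e) (stair l r s e)"
proof -
  have "successively lattice_step (stair l r s e)"
    using assms
  proof (induction rule: stair_induct)
    case (step s e)
    have "l s \<le> r s" and next_step: "l (s + 1) = r s \<or> l (s + 1) = r s + 1"
      using step(1,2) by (auto simp: stair_ok_def)
    then have "last (map (\<lambda>x. (x, s)) [l s..r s]) = (r s, s)"
      by (simp add: upto_rec2)
    moreover have "lattice_step (r s, s) (l (s + 1), s + 1)"
      using next_step by (auto simp: lattice_step_def)
    ultimately show ?case
      using step stair_hd[OF stair_ok_step[OF step(1,2)]]
      by (simp add: stair_rec successively_append_iff successively_segment)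
  qed (simp add: stair_same successively_segment)
  then show ?thesis
    using stair_hd[OF assms] stair_last[OF assms] by (simp add: is_lattice_path_def)
qed

text \<open>Induction on the path from its start: a point put in front either opens a new lowest
  height or extends the lowest interval to the left.\<close>

lemma path_is_stair:
  assumes "is_lattice_path p p' w"
  shows "\<exists>l r. w = stair l r (snd p) (snd p') \<and> stair_ok l r (snd p) (snd p') \<and>
    l (snd p) = fst p \<and> r (snd p') = fst p'"
proof -
  have "w \<noteq> []" using assms by (simp add: is_lattice_path_def)
  then show ?thesis
    using assms
  proof (induction w arbitrary: p rule: list_nonempty_induct)
    case (single x)
    then have "p = x" "p' = x" by (auto simp: is_lattice_path_def)
    then show ?case
      by (intro exI[of _ "\<lambda>_. fst x"]) (simp add: stair_same stair_ok_def)
  next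
    case (cons x w)
    let ?h = "hd w" and ?e = "snd p'"
    have p: "p = x" and step: "lattice_step x ?h" and path: "is_lattice_path ?h p' w"
      using cons.hyps cons.prems by (auto simp: is_lattice_path_def successively_Cons)
    from cons.IH[OF path] obtain l r where w: "w = stair l r (snd ?h) ?e"
      and ok: "stair_ok l r (snd ?h) ?e" and l: "l (snd ?h) = fst ?h" and r: "r ?e = fst p'"
      by blast
    obtain x1 x2 where x: "x = (x1, x2)" by (cases x)
    obtain h1 h2 where h: "?h = (h1, h2)" by (cases ?h)
    note w = w[unfolded h snd_conv] and ok = ok[unfolded h snd_conv] and l = l[unfolded h snd_conv fst_conv]
    have le: "h2 \<le> ?e" using ok by (simp add: stair_ok_def)
    consider (up) "h2 = x2 + 1" "h1 = x1 \<or> h1 = x1 + 1" | (east) "h2 = x2" "h1 = x1 + 1"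
      using step by (auto simp: lattice_step_def x h)
    then show ?case
    proof cases
      case up
      define l' r' where "l' = l(x2 := x1)" and "r' = r(x2 := x1)"
      have "stair l' r' (x2 + 1) ?e = w"
        unfolding w up by (rule stair_cong) (simp add: l'_def r'_def)
      moreover have "x2 < ?e" using le up by simp
      ultimately have "x # w = stair l' r' x2 ?e"
        by (simp add: stair_rec l'_def r'_def x)
      moreover have "stair_ok l' r' x2 ?e"
        using ok l up \<open>x2 < ?e\<close> by (auto simp: stair_ok_def l'_def r'_def)
      moreover have "l' x2 = x1" "r' ?e = fst p'"
        using \<open>x2 < ?e\<close> r by (simp_all add: l'_def r'_def)
      ultimately show ?thesis unfolding p x by auto
    next
      case east
      define l' where "l' = l(x2 := x1)"
      have lr: "l x2 \<le> r x2" using ok le east by (simp add: stair_ok_def)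
      then have seg: "map (\<lambda>x. (x, x2)) [l' x2..r x2] = x # map (\<lambda>x. (x, x2)) [l x2..r x2]"
        using l east by (simp add: l'_def upto_rec1 x)
      have "x # w = stair l' r x2 ?e"
      proof (cases "x2 = ?e")
        case True
        then show ?thesis using seg w east by (simp add: stair_same)
      next
        case False
        then have "x2 < ?e" using le east by simp
        moreover have "stair l' r (x2 + 1) ?e = stair l r (x2 + 1) ?e"
          by (rule stair_cong) (simp add: l'_def)
        ultimately show ?thesis using seg w east by (simp add: stair_rec)
      qed
      moreover have "stair_ok l' r x2 ?e"
        using ok l lr east by (auto simp: stair_ok_def l'_def)
      moreover have "l' x2 = x1" by (simp add: l'_def)
      ultimately show ?thesis unfolding p x using r by auto
    qed
  qed
qed

lemma path_steps_append:
  "xs \<noteq> [] \<Longrightarrow> ys \<noteq> [] \<Longrightarrow>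
    path_steps (xs @ ys) = path_steps xs @ (last xs, hd ys) # path_steps ys"
proof (induction xs rule: list_nonempty_induct)
  case (single x)
  then show ?case by (cases ys) (auto simp: path_steps_def)
next
  case (cons x xs)
  then show ?case by (cases xs) (auto simp: path_steps_def)
qed

lemma path_steps_segment:
  "(p, p') \<in> set (path_steps (map (\<lambda>x. (x, y)) [a..b])) \<Longrightarrow> snd p = y \<and> snd p' = y"
  by (auto simp: path_steps_def set_zip nth_tl)

lemma path_steps_stair:
  assumes "stair_ok l r s e" "s < e"
  shows "path_steps (stair l r s e) = path_steps (map (\<lambda>x. (x, s)) [l s..r s]) @
    ((r s, s), (l (s + 1), s + 1)) # path_steps (stair l r (s + 1) e)"
proof -
  have "l s \<le> r s" using assms by (auto simp: stair_ok_def)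
  then have "map (\<lambda>x. (x, s)) [l s..r s] \<noteq> []" "last (map (\<lambda>x. (x, s)) [l s..r s]) = (r s, s)"
    by (simp_all add: upto_rec2)
  then show ?thesis
    using stair_hd[OF stair_ok_step[OF assms], THEN conjunct1]
      stair_hd[OF stair_ok_step[OF assms], THEN conjunct2]
    by (simp only: stair_rec[OF assms(2)] path_steps_append simp_thms)
qed

lemma no_up_step_segment:
  "\<not> ((p, p') \<in> set (path_steps (map (\<lambda>x. (x, y)) [a..b])) \<and> snd p' = snd p + 1)"
proof
  assume asm: "(p, p') \<in> set (path_steps (map (\<lambda>x. (x, y)) [a..b])) \<and> snd p' = snd p + 1"
  then have "snd p = y \<and> snd p' = y" using path_steps_segment by blast
  with asm show False by simp
qed

text \<open>Horizontal runs contain no upward step, so only the joins between consecutive heights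
  remain.\<close>

lemma up_steps_stair:
  assumes "stair_ok l r s e"
  shows "(p, p') \<in> set (path_steps (stair l r s e)) \<and> snd p' = snd p + 1 \<longleftrightarrow>
    (\<exists>y. s \<le> y \<and> y < e \<and> p = (r y, y) \<and> p' = (l (y + 1), y + 1))"
  using assms
proof (induction rule: stair_induct)
  case (same e)
  show ?case unfolding stair_same using no_up_step_segment[of p p' e "l e" "r e"] by linarith
next
  case (step s e)
  let ?A = "path_steps (map (\<lambda>x. (x, s)) [l s..r s])" and ?B = "path_steps (stair l r (s + 1) e)"
  have mem: "(p, p') \<in> set (path_steps (stair l r s e)) \<longleftrightarrow>
      (p, p') \<in> set ?A \<or> p = (r s, s) \<and> p' = (l (s + 1), s + 1) \<or> (p, p') \<in> set ?B"
    unfolding path_steps_stair[OF step(1,2)] by (simp only: set_append list.set Un_iff insert_iff prod.inject[of p])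
  have "p = (r s, s) \<and> p' = (l (s + 1), s + 1) \<longrightarrow> snd p' = snd p + 1" by simp
  then have "(p, p') \<in> set (path_steps (stair l r s e)) \<and> snd p' = snd p + 1 \<longleftrightarrow>
      p = (r s, s) \<and> p' = (l (s + 1), s + 1) \<or> (p, p') \<in> set ?B \<and> snd p' = snd p + 1"
    unfolding mem using no_up_step_segment[of p p' s "l s" "r s"] by argo
  also have "\<dots> \<longleftrightarrow> (\<exists>y. s \<le> y \<and> y < e \<and> p = (r y, y) \<and> p' = (l (y + 1), y + 1))"
  proof -
    have "s \<le> y \<and> y < e \<longleftrightarrow> y = s \<or> s + 1 \<le> y \<and> y < e" for y
      using step(2) by linarith
    then have "(\<exists>y. s \<le> y \<and> y < e \<and> Q y) \<longleftrightarrow> Q s \<or> (\<exists>y. s + 1 \<le> y \<and> y < e \<and> Q y)" for Q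
      by metis
    from this[symmetric] show ?thesis unfolding step.IH .
  qed
  finally show ?case .
qed

lemma no_diagonal:
  "filter (\<lambda>(p, p'). p' - p = (1, 1)) (path_steps (map (\<lambda>x. (x, y)) [a..b])) = []"
proof -
  have "\<not> (\<lambda>(p, p'). p' - p = (1, 1)) c"
    if "c \<in> set (path_steps (map (\<lambda>x. (x, y)) [a..b]))" for c
    using that path_steps_segment[of "fst c" "snd c" y a b]
    by (cases c) (auto simp: prod_eq_iff)
  then show ?thesis by (simp only: filter_empty_conv) blast
qed

lemma diagonal_steps_stair:
  assumes "stair_ok l r s e"
  shows "length (filter (\<lambda>(p, p'). p' - p = (1, 1)) (path_steps (stair l r s e)))
    = card {y. s \<le> y \<and> y < e \<and> l (y + 1) = r y + 1}"
  using assms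
proof (induction rule: stair_induct)
  case (same e)
  have *: "{y. e \<le> y \<and> y < e \<and> l (y + 1) = r y + 1} = {}" by auto
  show ?case unfolding * by (simp add: stair_same no_diagonal)
next
  case (step s e)
  have "{y. s \<le> y \<and> y < e \<and> l (y + 1) = r y + 1} =
      (if l (s + 1) = r s + 1 then {s} else {}) \<union> {y. s + 1 \<le> y \<and> y < e \<and> l (y + 1) = r y + 1}"
    using step(2) by (auto simp: order.order_iff_strict)
  moreover have "finite {y. s + 1 \<le> y \<and> y < e \<and> l (y + 1) = r y + 1}"
    by (rule finite_subset[of _ "{s + 1..e}"]) auto
  ultimately show ?case
    unfolding path_steps_stair[OF step(1,2)] using step.IH by (simp add: no_diagonal)
qed

lemma up_step_at:
  assumes ok: "stair_ok l r s e" and "s \<le> i" "i < e"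
  shows "(p, p') \<in> set (path_steps (stair l r s e)) \<and> snd p = i \<and> snd p' = i + 1 \<longleftrightarrow>
    p = (r i, i) \<and> p' = (l (i + 1), i + 1)" (is "?A \<longleftrightarrow> ?B")
proof
  assume A: ?A
  then have "(p, p') \<in> set (path_steps (stair l r s e)) \<and> snd p' = snd p + 1" by simp
  then obtain y where "p = (r y, y)" "p' = (l (y + 1), y + 1)"
    using up_steps_stair[OF ok] by blast
  with A show ?B by simp
next
  assume B: ?B
  then have "(p, p') \<in> set (path_steps (stair l r s e)) \<and> snd p' = snd p + 1"
    using up_steps_stair[OF ok, of p p'] assms(2,3) by blast
  with B show ?A by simp
qed

text \<open>Whether the step is north or diagonal, the triangle at \<open>c\<close> lies to its
  right iff \<open>r i \<le> c\<close>; lying to the left of \<open>y = x\<close> means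
  \<open>c + 1 \<le> i\<close>.\<close>

lemma row_area_stair:
  assumes "stair_ok l r s e" "s \<le> int i" "int i < e"
  shows "row_area (stair l r s e) i = nat (int i - r (int i))"
proof -
  have d: "l (int i + 1) = r (int i) \<or> l (int i + 1) = r (int i) + 1"
    using assms by (auto simp: stair_ok_def)
  have "{c. (\<exists>(p, p')\<in>set (path_steps (stair l r s e)). snd p = int i \<and> snd p' = int i + 1 \<and>
        (\<forall>r\<in>area_triangle c (int i). weakly_right_of (p, p') r)) \<and>
     (\<forall>(x, y)\<in>area_triangle c (int i). x \<le> y)} = {r (int i)..int i - 1}" (is "?S = _")
  proof (rule set_eqI)
    fix c
    have ex: "(\<exists>(p, p')\<in>set (path_steps (stair l r s e)). snd p = int i \<and> snd p' = int i + 1 \<and> Q p p') \<longleftrightarrow>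
        Q (r (int i), int i) (l (int i + 1), int i + 1)" for Q
    proof -
      have "(\<exists>(p, p')\<in>set (path_steps (stair l r s e)). snd p = int i \<and> snd p' = int i + 1 \<and> Q p p') \<longleftrightarrow>
          (\<exists>p p'. ((p, p') \<in> set (path_steps (stair l r s e)) \<and> snd p = int i \<and> snd p' = int i + 1) \<and> Q p p')"
        by blast
      then show ?thesis unfolding up_step_at[OF assms] by simp
    qed
    show "c \<in> ?S \<longleftrightarrow> c \<in> {r (int i)..int i - 1}"
      unfolding mem_Collect_eq ex using d by (auto simp: area_triangle_def)
  qed
  then show ?thesis by (simp add: row_area_def)
qed

lemma decorated_stair:
  assumes "stair_ok l r s e" "s \<le> int i" "int i < e"
  shows "decorated (stair l r s e) i \<longleftrightarrow> l (int i + 1) = r (int i) + 1"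
proof -
  have "((x, int i), (x + 1, int i + 1)) \<in> set (path_steps (stair l r s e)) \<longleftrightarrow>
      x = r (int i) \<and> x + 1 = l (int i + 1)" for x
    using up_step_at[OF assms, of "(x, int i)" "(x + 1, int i + 1)"]
    unfolding snd_conv prod.inject by blast
  then have "decorated (stair l r s e) i \<longleftrightarrow> (\<exists>x. x = r (int i) \<and> x + 1 = l (int i + 1))"
    unfolding decorated_def by blast
  then show ?thesis by auto
qed

section \<open>Tuples of paths as configurations\<close>

definition left_end :: "nat \<Rightarrow> (nat \<times> nat \<Rightarrow> nat) \<Rightarrow> (nat \<times> nat) set \<Rightarrow> nat \<Rightarrow> int \<Rightarrow> int" where
  "left_end n a U u y = (if y < int n then int u else y - int (raised a U (nat (y - int n), u)))"

text \<open>From height \<open>n\<close> on, ends of intervals are given by their horizontal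
  distance to \<open>y = x\<close>. For the step across strip \<open>n - 1 + r\<close> this distance
  is \<open>a (r, u)\<close> at its bottom and \<open>raised a U (r, u)\<close> at its top. So at
  height \<open>n + k\<close> the left end uses row \<open>k\<close> and the right end row
  \<open>Suc k\<close>.\<close>

definition right_end :: "nat \<Rightarrow> (nat \<times> nat \<Rightarrow> nat) \<Rightarrow> nat \<Rightarrow> int \<Rightarrow> int" where
  "right_end n a u y = (if y < int n then int u else y - int (a (Suc (nat (y - int n)), u)))"

definition config_path :: "nat \<Rightarrow> (nat \<times> nat \<Rightarrow> nat) \<Rightarrow> (nat \<times> nat) set \<Rightarrow> nat \<Rightarrow> path" where
  "config_path n a U u = stair (left_end n a U u) (right_end n a u) (int u) (2 * int n - 1 - int u)"

definition config_tuple :: "nat \<Rightarrow> (nat \<times> nat \<Rightarrow> nat) \<times> (nat \<times> nat) set \<Rightarrow> path list" where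
  "config_tuple n = (\<lambda>(a, U). map (config_path n a U) [0..<n])"

lemma config_tuple_nth: "u < n \<Longrightarrow> config_tuple n (a, U) ! u = config_path n a U u"
  by (simp add: config_tuple_def)

lemma left_end_upper: "left_end n a U u (int n + int r) = int n + int r - int (raised a U (r, u))"
  by (simp add: left_end_def)

lemma right_end_upper: 
  assumes "(a, U) \<in> configs n" "r + u < n"
  shows "right_end n a u (int n - 1 + int r) = int n - 1 + int r - int (a (r, u))"
proof (cases r)
  case 0
  then show ?thesis using assms by (simp add: right_end_def configs_def of_nat_diff)
next
  case (Suc k)
  then have "int n - 1 + int r = int n + int k" by simp
  then show ?thesis by (simp add: right_end_def Suc)
qed

text \<open>The second inequality extends to the last entry of each path, where
  \<open>a (Suc r, u)\<close> lies outside the triangle and is 0.\<close>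

lemma config_ineq:
  assumes "(a, U) \<in> configs n"
  shows "r + Suc u < n \<Longrightarrow> raised a U (r, Suc u) < a (Suc r, u)" "r + u < n \<Longrightarrow> a (Suc r, u) \<le> raised a U (r, u)"
proof -
  show "r + Suc u < n \<Longrightarrow> raised a U (r, Suc u) < a (Suc r, u)"
    using assms by (simp add: configs_def)
  assume "r + u < n"
  then consider "r + Suc u < n" | "(Suc r, u) \<notin> tri n" by fastforce
  then show "a (Suc r, u) \<le> raised a U (r, u)"
  proof cases
    case 1
    then show ?thesis using assms by (simp add: configs_def)
  next
    case 2
    then have "a (Suc r, u) = 0" using assms unfolding configs_def by blast
    then show ?thesis by simp
  qed
qed

lemma raised_antimono:
  assumes "(a, U) \<in> configs n" "u \<le> v" "r + v < n"
  shows "raised a U (r, v) \<le> raised a U (r, u)"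
  using assms(2,3)
proof (induction v rule: dec_induct)
  case (step v)
  then have "raised a U (r, Suc v) < a (Suc r, v)" "a (Suc r, v) \<le> raised a U (r, v)"
    using config_ineq[OF assms(1), of r v] by auto
  then show ?case using step by simp
qed simp

lemma height_cases [consumes 2]:
  assumes "y \<le> 2 * int n - 1 - int u" "u < n"
  obtains (low) "y < int n" | (high) r where "y = int n + int r" "r + u < n"
proof (cases "y < int n")
  case False
  then have "y = int n + int (nat (y - int n))" "nat (y - int n) + u < n"
    using assms by auto
  then show ?thesis using that(2) by blast
qed (use that(1) in blast)

lemma step_height_cases [consumes 2]:
  assumes "y < 2 * int n - 1 - int u" "u < n"
  obtains (low) "y + 1 < int n" | (high) r where "y = int n - 1 + int r" "r + u < n"
proof (cases "y + 1 < int n")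
  case False
  then have "y = int n - 1 + int (nat (y + 1 - int n))" "nat (y + 1 - int n) + u < n"
    using assms by auto
  then show ?thesis using that(2) by blast
qed (use that(1) in blast)

lemma left_right_step:
  assumes c: "(a, U) \<in> configs n" and "r + u < n"
  shows "left_end n a U u (int n + int r) = right_end n a u (int n - 1 + int r) + of_bool ((r, u) \<notin> U)"
  unfolding left_end_upper right_end_upper[OF assms] by (simp add: raised_def)

lemma config_stair_ok:
  assumes c: "(a, U) \<in> configs n" and u: "u < n"
  shows "stair_ok (left_end n a U u) (right_end n a u) (int u) (2 * int n - 1 - int u)"
  unfolding stair_ok_def
proof (intro conjI ballI)
  fix y assume "y \<in> {int u..2 * int n - 1 - int u}"
  then have "y \<le> 2 * int n - 1 - int u" by simp
  from this u show "left_end n a U u y \<le> right_end n a u y"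
  proof (cases rule: height_cases)
    case (high r)
    then show ?thesis using config_ineq(2)[OF c high(2)] by (simp add: left_end_def right_end_def)
  qed (simp_all add: left_end_def right_end_def)
next
  fix y assume "y \<in> {int u..<2 * int n - 1 - int u}"
  then have "y < 2 * int n - 1 - int u" by simp
  from this u show "left_end n a U u (y + 1) = right_end n a u y \<or> left_end n a U u (y + 1) = right_end n a u y + 1"
  proof (cases rule: step_height_cases)
    case (high r)
    then have "y + 1 = int n + int r" by simp
    then show ?thesis using left_right_step[OF c high(2)] high(1) by simp
  qed (simp_all add: left_end_def right_end_def)
qed (use u in simp)

lemma strip_end: "j < n \<Longrightarrow> int (j + strip_length n j) = 2 * int n - 1 - int j"
  by (simp add: strip_length_def of_nat_diff)

text \<open>Paths are disjoint because, at every common height, the interval of a path ends before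
  that of any path with larger index begins.\<close>

lemma config_tuple_mem:
  assumes c: "(a, U) \<in> configs n"
  shows "config_tuple n (a, U) \<in> path_tuples n"
proof -
  have out: "a (Suc r, u) = 0" if "n \<le> Suc r + u" for r u
    using c that unfolding configs_def by (auto simp: tri_def)
  have disj: "set (config_path n a U u) \<inter> set (config_path n a U v) = {}" if uv: "u < v" "v < n" for u v
  proof -
    have False if x: "(x, y) \<in> set (config_path n a U u)" "(x, y) \<in> set (config_path n a U v)" for x y
    proof -
      have bounds: "y \<le> 2 * int n - 1 - int v" "x \<le> right_end n a u y" "left_end n a U v y \<le> x" "int v \<le> y"
        "x \<le> right_end n a v y" "left_end n a U u y \<le> x"
        using x by (auto simp: config_path_def set_stair)
      from bounds(1) uv(2) show False
      proof (cases rule: height_cases)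
        case low
        then show ?thesis using bounds uv by (simp add: left_end_def right_end_def)
      next
        case (high r)
        have "raised a U (r, Suc u) < a (Suc r, u)" "raised a U (r, v) \<le> raised a U (r, Suc u)"
          using config_ineq(1)[OF c, of r u] raised_antimono[OF c, of "Suc u" v r] high uv by auto
        then show ?thesis using bounds high by (simp add: left_end_def right_end_def)
      qed
    qed
    then show ?thesis by auto
  qed
  have path: "is_lattice_path (int u, int u) (int (u + strip_length n u), int (u + strip_length n u))
      (config_path n a U u)" if u: "u < n" for u
  proof -
    have e: "2 * int n - 1 - int u = int n + int (n - 1 - u)" using u by simp
    have "right_end n a u (2 * int n - 1 - int u) = 2 * int n - 1 - int u"
    proof -
      have "right_end n a u (int n + int k) = int n + int k - int (a (Suc k, u))" for k
        by (simp add: right_end_def)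
      \<comment> \<open>The default value 0 outside the triangle puts the endpoint on
        \<open>y = x\<close>.\<close>
      moreover have "a (Suc (n - 1 - u), u) = 0" using out u by simp
      ultimately show ?thesis unfolding e by (simp only:)
    qed
    moreover have "left_end n a U u (int u) = int u" using u by (simp add: left_end_def)
    ultimately show ?thesis
      using stair_is_path[OF config_stair_ok[OF c u]] unfolding strip_end[OF u] config_path_def by simp
  qed
  have above: "weakly_above_diagonal (config_path n a U u)" for u
    by (auto simp: weakly_above_diagonal_def config_path_def set_stair right_end_def split: if_splits)
  have "non_intersecting (config_tuple n (a, U) ! i) (config_tuple n (a, U) ! j)"
    if "i < n" "j < n" "i \<noteq> j" for i j
    using disj[of i j] disj[of j i] that by (cases i j rule: linorder_cases)
      (auto simp: non_intersecting_def config_tuple_nth)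
  then show ?thesis
    using path above by (simp add: path_tuples_def config_tuple_nth) (simp add: config_tuple_def)
qed

text \<open>Non-intersection orders the paths from left to right. This forces their lower parts to
  be vertical, and the upper parts are then read off as \<open>a\<close> and
  \<open>U\<close>.\<close>

lemma path_tuple_is_config:
  assumes "\<pi> \<in> path_tuples n"
  shows "\<pi> \<in> config_tuple n ` configs n"
proof -
  define e where "e j = 2 * int n - 1 - int j" for j :: nat
  have "\<exists>l r. \<pi> ! j = stair l r (int j) (e j) \<and> stair_ok l r (int j) (e j) \<and> l (int j) = int j \<and> r (e j) = e j"
    if "j < n" for j
  proof -
    have "is_lattice_path (int j, int j) (int (j + strip_length n j), int (j + strip_length n j)) (\<pi> ! j)"
      using assms that by (simp add: path_tuples_def)
    then have "is_lattice_path (int j, int j) (e j, e j) (\<pi> ! j)"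
      unfolding strip_end[OF that] e_def .
    from path_is_stair[OF this] show ?thesis by simp
  qed
  then obtain l r where \<pi>: "\<And>j. j < n \<Longrightarrow> \<pi> ! j = stair (l j) (r j) (int j) (e j)"
    and ok: "\<And>j. j < n \<Longrightarrow> stair_ok (l j) (r j) (int j) (e j)"
    and l: "\<And>j. j < n \<Longrightarrow> l j (int j) = int j" and r: "\<And>j. j < n \<Longrightarrow> r j (e j) = e j"
    by metis
  have lr: "l j y \<le> r j y" if "j < n" "int j \<le> y" "y \<le> e j" for j y
    using ok[OF that(1)] that by (simp add: stair_ok_def)
  have row_step: "l j (y + 1) = r j y \<or> l j (y + 1) = r j y + 1" if "j < n" "int j \<le> y" "y < e j" for j y
    using ok[OF that(1)] that by (simp add: stair_ok_def)
  have mem: "(x, y) \<in> set (\<pi> ! j) \<longleftrightarrow> int j \<le> y \<and> y \<le> e j \<and> l j y \<le> x \<and> x \<le> r j y" if "j < n" for j x y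
    unfolding \<pi>[OF that] set_stair by simp
  have above: "r j y \<le> y" if "j < n" "int j \<le> y" "y \<le> e j" for j y
  proof -
    have "(r j y, y) \<in> set (\<pi> ! j)" using lr that mem by simp
    moreover have "weakly_above_diagonal (\<pi> ! j)" using assms that(1) by (simp add: path_tuples_def)
    ultimately show ?thesis by (auto simp: weakly_above_diagonal_def)
  qed
  have no_common: "\<not> (l (Suc j) y \<le> x \<and> x \<le> r (Suc j) y \<and> l j y \<le> x \<and> x \<le> r j y)"
    if "Suc j < n" "int (Suc j) \<le> y" "y \<le> e (Suc j)" for j x y
  proof -
    have "set (\<pi> ! j) \<inter> set (\<pi> ! Suc j) = {}"
      using assms that(1) unfolding path_tuples_def non_intersecting_def by auto
    then have "\<not> ((x, y) \<in> set (\<pi> ! j) \<and> (x, y) \<in> set (\<pi> ! Suc j))" by blast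
    then show ?thesis using that mem[of j x y] mem[of "Suc j" x y] by (auto simp: e_def)
  qed
  \<comment> \<open>Path \<open>j\<close> cannot pass path \<open>Suc j\<close>: its interval at
    height \<open>y + 1\<close> starts no further right than that of path \<open>Suc j\<close>, so
    reaching the start of the latter would create a common point. The base case is the starting
    point of path \<open>Suc j\<close>.\<close>
  have separated: "r j y < l (Suc j) y" if j: "Suc j < n" and y: "int (Suc j) \<le> y" "y \<le> e (Suc j)" for j y
    using y
  proof (induction y rule: int_ge_induct)
    case base
    have "r j (int j) \<le> int j" using above[of j "int j"] j by (simp add: e_def)
    moreover have "l j (int j + 1) = r j (int j) \<or> l j (int j + 1) = r j (int j) + 1"
      using row_step[of j "int j"] j by (simp add: e_def)
    moreover have "r j (int j + 1) \<le> int j + 1" using above[of j "int j + 1"] j by (simp add: e_def)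
    moreover have "l (Suc j) (int j + 1) = int j + 1" using l[of "Suc j"] j by (simp add: add.commute)
    moreover have "int j + 1 \<le> r (Suc j) (int j + 1)"
      using lr[of "Suc j" "int j + 1"] j calculation(4) by (simp add: e_def)
    ultimately show ?case
      using no_common[of j "int j + 1" "int j + 1"] j by (simp add: e_def add.commute) linarith
  next
    case (step y)
    have "r j y < l (Suc j) y" using step by simp
    moreover have "l (Suc j) y \<le> r (Suc j) y" using lr[of "Suc j" y] step j by simp
    moreover have "r (Suc j) y \<le> l (Suc j) (y + 1)"
      using row_step[of "Suc j" y] step j by auto
    moreover have "l j (y + 1) \<le> r j y + 1"
      using row_step[of j y] step j
      by (auto simp: e_def)
    moreover have "l (Suc j) (y + 1) \<le> r (Suc j) (y + 1)" using lr[of "Suc j" "y + 1"] step j by simp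
    ultimately show ?case
      using no_common[of j "y + 1" "l (Suc j) (y + 1)"] step j by simp
  qed
  \<comment> \<open>At the same height path \<open>j\<close> is strictly left of path
    \<open>Suc j\<close>, which has risen one unit less and so is bounded by the induction
    hypothesis.\<close>
  have frozen_le: "r j (int j + int k) \<le> int j" if "j + k < n" for j k
    using that
  proof (induction k arbitrary: j)
    case 0
    then show ?case using above[of j "int j"] by (simp add: e_def)
  next
    case (Suc k)
    have "r j (int j + int (Suc k)) < l (Suc j) (int j + int (Suc k))"
      using separated[of j "int j + int (Suc k)"] Suc.prems by (simp add: e_def)
    also have "\<dots> \<le> r (Suc j) (int j + int (Suc k))"
      using lr[of "Suc j" "int j + int (Suc k)"] Suc.prems by (simp add: e_def)
    also have "int j + int (Suc k) = int (Suc j) + int k" by simp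
    finally have "r j (int (Suc j) + int k) < r (Suc j) (int (Suc j) + int k)" by simp
    then show ?case using Suc.IH[of "Suc j"] Suc.prems by (simp add: algebra_simps)
  qed
  have frozen_ge: "int j \<le> l j (int j + int k)" if "j + k < n" for j k
    using that
  proof (induction k)
    case 0
    then show ?case using l[of j] by simp
  next
    case (Suc k)
    have "int j \<le> r j (int j + int k)"
      using Suc lr[of j "int j + int k"] by (simp add: e_def)
    then show ?case using row_step[of j "int j + int k"] Suc.prems by (auto simp: e_def add_ac)
  qed
  have frozen: "l j y = int j \<and> r j y = int j" if "j < n" "int j \<le> y" "y < int n" for j y
  proof -
    have y: "y = int j + int (nat (y - int j))" "j + nat (y - int j) < n" using that by auto
    show ?thesis
      using frozen_le[OF y(2)] frozen_ge[OF y(2)] lr[of j y] that unfolding y(1)[symmetric]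
      by (simp add: e_def)
  qed
  \<comment> \<open>Distances to \<open>y = x\<close> at the bottom of each strip from
    \<open>n - 1\<close> on; \<open>U\<close> collects the strips crossed by a north step.\<close>
  define a where "a = (\<lambda>(k, u). if k + u < n then nat (int n - 1 + int k - r u (int n - 1 + int k)) else 0)"
  define U where "U = {(k, u). k + u < n \<and> l u (int n + int k) = r u (int n - 1 + int k)}"
  have a: "int (a (k, u)) = int n - 1 + int k - r u (int n - 1 + int k)" if "k + u < n" for k u
    using that above[of u "int n - 1 + int k"] by (simp add: a_def e_def)
  have b: "int (raised a U (k, u)) = int n + int k - l u (int n + int k)" if "k + u < n" for k u
    using row_step[of u "int n - 1 + int k"] that a[OF that]
    by (auto simp: raised_def U_def e_def)
  \<comment> \<open>This includes the end of the path, where the default 0 is its true distance to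
    \<open>y = x\<close>.\<close>
  have a_Suc: "int (a (Suc k, u)) = int n + int k - r u (int n + int k)" if "k + u < n" for k u
  proof (cases "Suc k + u < n")
    case True
    then show ?thesis using a[OF True] by (simp add: algebra_simps)
  next
    case False
    then have "int n + int k = e u" using that by (simp add: e_def)
    then show ?thesis using False r[of u] that by (simp add: a_def)
  qed
  have conf: "(a, U) \<in> configs n"
  proof -
    have "raised a U (k, Suc u) < a (Suc k, u) \<and> a (Suc k, u) \<le> raised a U (k, u)" if ku: "k + Suc u < n" for k u
    proof -
      have "r u (int n + int k) < l (Suc u) (int n + int k)"
        using separated[of u "int n + int k"] ku by (simp add: e_def)
      moreover have "l u (int n + int k) \<le> r u (int n + int k)"
        using lr[of u "int n + int k"] ku by (simp add: e_def)
      ultimately show ?thesis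
        using a_Suc[of k u] b[of k u] b[of k "Suc u"] ku by simp
    qed
    moreover have "a (0, u) = n - 1 - u" if "u < n" for u
      using a[of 0 u] frozen[of u "int n - 1"] that by simp
    moreover have "U \<subseteq> tri n" by (auto simp: U_def)
    moreover have "a p = 0" if "p \<notin> tri n" for p
      using that by (cases p) (simp add: a_def)
    ultimately show ?thesis unfolding configs_def by blast
  qed
  have "\<pi> ! u = config_tuple n (a, U) ! u" if u: "u < n" for u
    unfolding config_tuple_nth[OF u] config_path_def \<pi>[OF u] e_def[symmetric]
  proof (rule stair_cong)
    fix y assume y: "int u \<le> y" "y \<le> e u"
    from y(2)[unfolded e_def] u show "l u y = left_end n a U u y \<and> r u y = right_end n a u y"
    proof (cases rule: height_cases)
      case low
      then show ?thesis using frozen[OF u y(1)] by (simp add: left_end_def right_end_def)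
    next
      case (high k)
      then show ?thesis using a_Suc[of k u] b[of k u] by (simp add: left_end_def right_end_def)
    qed
  qed
  moreover have "length \<pi> = n" using assms by (simp add: path_tuples_def)
  ultimately have "\<pi> = config_tuple n (a, U)"
    by (intro nth_equalityI) (auto simp: config_tuple_def)
  with conf show ?thesis by blast
qed

section \<open>Statistics\<close>

lemma row_low:
  assumes c: "(a, U) \<in> configs n" and "u \<le> i" "Suc i < n"
  shows "row_area (config_path n a U u) i = i - u" "\<not> decorated (config_path n a U u) i"
proof -
  have u: "u < n" using assms by simp
  have i: "int u \<le> int i" "int i < 2 * int n - 1 - int u" using assms by auto
  have ends: "right_end n a u (int i) = int u" "left_end n a U u (int i + 1) = int u"
    using assms by (simp_all add: right_end_def left_end_def)
  show "row_area (config_path n a U u) i = i - u"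
    unfolding config_path_def row_area_stair[OF config_stair_ok[OF c u] i] ends
    using assms(2) by (simp add: nat_diff_distrib)
  show "\<not> decorated (config_path n a U u) i"
    unfolding config_path_def decorated_stair[OF config_stair_ok[OF c u] i] ends by simp
qed

lemma row_high:
  assumes c: "(a, U) \<in> configs n" and ru: "r + u < n"
  shows "row_area (config_path n a U u) (n - 1 + r) = a (r, u)"
    "decorated (config_path n a U u) (n - 1 + r) \<longleftrightarrow> (r, u) \<notin> U"
proof -
  have u: "u < n" using ru by simp
  have i: "int u \<le> int (n - 1 + r)" "int (n - 1 + r) < 2 * int n - 1 - int u" using ru by auto
  have int_i: "int (n - 1 + r) = int n - 1 + int r" using ru by simp
  show "row_area (config_path n a U u) (n - 1 + r) = a (r, u)"
    unfolding config_path_def row_area_stair[OF config_stair_ok[OF c u] i]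
    unfolding int_i right_end_upper[OF c ru] by simp
  have "int n - 1 + int r + 1 = int n + int r" by simp
  then show "decorated (config_path n a U u) (n - 1 + r) \<longleftrightarrow> (r, u) \<notin> U"
    unfolding config_path_def decorated_stair[OF config_stair_ok[OF c u] i] int_i
    using left_right_step[OF c ru] by simp
qed

text \<open>By \<open>row_high\<close>, \<open>a\<close> and \<open>U\<close> are recovered from the
  area entries and the decorations.\<close>

lemma config_tuple_inj: "inj_on (config_tuple n) (configs n)"
proof (rule inj_onI)
  fix x y assume x: "x \<in> configs n" and y: "y \<in> configs n" and eq: "config_tuple n x = config_tuple n y"
  obtain a U b V where [simp]: "x = (a, U)" "y = (b, V)" by (cases x; cases y)
  have c: "(a, U) \<in> configs n" "(b, V) \<in> configs n" using x y by simp_all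
  have path: "config_path n a U u = config_path n b V u" if "u < n" for u
    using config_tuple_nth[OF that, of a U] config_tuple_nth[OF that, of b V] eq by simp
  have in_tri: "a (r, u) = b (r, u) \<and> ((r, u) \<in> U \<longleftrightarrow> (r, u) \<in> V)" if "r + u < n" for r u
    using row_high[OF c(1) that] row_high[OF c(2) that] path[of u] that by simp
  have "a p = b p" for p
  proof (cases "p \<in> tri n")
    case True
    then show ?thesis using in_tri by (cases p) simp
  next
    case False
    then have "a p = 0" "b p = 0" using c unfolding configs_def by blast+
    then show ?thesis by simp
  qed
  moreover have "U \<subseteq> tri n" "V \<subseteq> tri n" using c by (simp_all add: configs_def)
  then have "U = V" using in_tri by (auto simp: tri_def)
  ultimately show "x = y" by auto
qed

lemma config_tuple_bij: "bij_betw (config_tuple n) (configs n) (path_tuples n)"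
  unfolding bij_betw_def using config_tuple_inj config_tuple_mem path_tuple_is_config by fast

lemma sum_entries:
  "(\<Sum>p\<in>entry_indices n. f p) = (\<Sum>i<n - 1. \<Sum>j\<le>i. f (j, i)) + (\<Sum>(r, u)\<in>tri n. f (u, n - 1 + r))"
proof -
  let ?A = "SIGMA i:{..<n - 1}. {..i}"
  let ?f = "\<lambda>(i, j). (j, i)" and ?g = "\<lambda>(r, u). (u, n - 1 + r)"
  have "entry_indices n = ?f ` ?A \<union> ?g ` tri n"
  proof (intro set_eqI iffI)
    fix p assume "p \<in> entry_indices n"
    then obtain j i where p: "p = (j, i)" "j < n" "j \<le> i" "i < 2 * n - 1 - j"
      by (auto simp: entry_indices_def strip_length_def)
    show "p \<in> ?f ` ?A \<union> ?g ` tri n"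
    proof (cases "i < n - 1")
      case True
      then show ?thesis using p by auto
    next
      case False
      then have "p = ?g (i - (n - 1), j)" "(i - (n - 1), j) \<in> tri n" using p by auto
      then show ?thesis by blast
    qed
  qed (auto simp: entry_indices_def strip_length_def)
  moreover have "?f ` ?A \<inter> ?g ` tri n = {}" by auto
  ultimately have "(\<Sum>p\<in>entry_indices n. f p) = sum f (?f ` ?A) + sum f (?g ` tri n)"
    by (simp add: sum.union_disjoint)
  moreover have "sum f (?f ` ?A) = (\<Sum>i<n - 1. \<Sum>j\<le>i. f (j, i))"
    by (subst sum.reindex) (auto simp: inj_on_def sum.Sigma case_prod_unfold)
  moreover have "sum f (?g ` tri n) = (\<Sum>(r, u)\<in>tri n. f (u, n - 1 + r))"
    by (subst sum.reindex) (auto simp: inj_on_def case_prod_unfold intro!: sum.cong)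
  ultimately show ?thesis by simp
qed

lemma diags_config:
  assumes c: "(a, U) \<in> configs n"
  shows "diags (config_tuple n (a, U)) = card (tri n - U)"
proof -
  let ?D = "\<lambda>u. {r. r + u < n \<and> (r, u) \<notin> U}"
  have fin: "finite (?D u)" for u
    by (rule finite_subset[of _ "{..n}"]) auto
  have path: "length (filter (\<lambda>(p, p'). p' - p = (1, 1)) (path_steps (config_path n a U u))) = card (?D u)"
    if u: "u < n" for u
  proof -
    let ?S = "{y. int u \<le> y \<and> y < 2 * int n - 1 - int u \<and> left_end n a U u (y + 1) = right_end n a u y + 1}"
    have diagonal: "left_end n a U u (int n - 1 + int r + 1) = right_end n a u (int n - 1 + int r) + 1 \<longleftrightarrow> (r, u) \<notin> U"
      if "r + u < n" for r
      using left_right_step[OF c that] by simp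
    have "?S = (\<lambda>r. int n - 1 + int r) ` ?D u"
    proof (intro set_eqI iffI)
      fix y assume y: "y \<in> ?S"
      then have "y < 2 * int n - 1 - int u" by simp
      from this u show "y \<in> (\<lambda>r. int n - 1 + int r) ` ?D u"
      proof (cases rule: step_height_cases)
        case low
        then show ?thesis using y by (simp add: left_end_def right_end_def)
      next
        case (high r)
        then show ?thesis using y diagonal[of r] by auto
      qed
    next
      fix y assume "y \<in> (\<lambda>r. int n - 1 + int r) ` ?D u"
      then obtain r where "y = int n - 1 + int r" "r + u < n" "(r, u) \<notin> U" by auto
      then show "y \<in> ?S" using diagonal[of r] by simp
    qed
    then have "card ?S = card (?D u)"
      by (simp add: card_image inj_on_def)
    then show ?thesis
      unfolding config_path_def diagonal_steps_stair[OF config_stair_ok[OF c u]] .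
  qed
  have "diags (config_tuple n (a, U)) = (\<Sum>u<n. card (?D u))"
  proof -
    have "diags (config_tuple n (a, U))
        = (\<Sum>u<n. length (filter (\<lambda>(p, p'). p' - p = (1, 1)) (path_steps (config_path n a U u))))"
      by (simp add: diags_def config_tuple_def comp_def interv_sum_list_conv_sum_set_nat atLeast0LessThan)
    also have "\<dots> = (\<Sum>u<n. card (?D u))"
      by (rule sum.cong[OF refl]) (simp only: lessThan_iff path)
    finally show ?thesis .
  qed
  also have "\<dots> = card (SIGMA u:{..<n}. ?D u)"
    using fin by simp
  also have "\<dots> = card ((\<lambda>(u, r). (r, u)) ` (SIGMA u:{..<n}. ?D u))"
    by (rule card_image[symmetric]) (auto simp: inj_on_def)
  also have "(\<lambda>(u, r). (r, u)) ` (SIGMA u:{..<n}. ?D u) = tri n - U"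
    by (auto simp: tri_def image_iff)
  finally show ?thesis .
qed

lemma area_config:
  assumes c: "(a, U) \<in> configs n"
  shows "area n (config_tuple n (a, U)) = (\<Sum>i<n - 1. \<Sum>{..i}) + (\<Sum>p\<in>tri n. a p)"
proof -
  let ?X = "\<lambda>(j, i). row_area (config_tuple n (a, U) ! j) i"
  have "(\<Sum>j\<le>i. ?X (j, i)) = \<Sum>{..i}" if "i < n - 1" for i
  proof -
    have "(\<Sum>j\<le>i. ?X (j, i)) = (\<Sum>j\<le>i. i - j)"
      by (rule sum.cong) (use that in \<open>simp_all add: config_tuple_nth row_low[OF c]\<close>)
    then show ?thesis by (simp add: sum_diff_atMost)
  qed
  moreover have "(\<Sum>(r, u)\<in>tri n. ?X (u, n - 1 + r)) = (\<Sum>p\<in>tri n. a p)"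
  proof (rule sum.cong[OF refl])
    fix p assume "p \<in> tri n"
    then show "(case p of (r, u) \<Rightarrow> ?X (u, n - 1 + r)) = a p"
      using row_high(1)[OF c, of "fst p" "snd p"] by (cases p) (simp add: config_tuple_nth)
  qed
  ultimately show ?thesis
    by (simp add: area_def sum_entries)
qed

section \<open>Counting dinv pairs\<close>

lemma card_eq_sum_of_bool: "finite A \<Longrightarrow> card {x \<in> A. P x} = (\<Sum>x\<in>A. of_bool (P x))"
  by (simp add: sum_of_bool_eq Int_def)

lemma sum_of_bool_eq_diff:
  fixes i v :: nat
  assumes "v \<le> i"
  shows "(\<Sum>j\<le>i. of_bool (i - j = v \<and> P)) = (of_bool P :: nat)"
proof -
  have "(\<Sum>j\<le>i. of_bool (i - j = v \<and> P) :: nat) = (\<Sum>j\<le>i. if j = i - v then of_bool P else 0)"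
    by (rule sum.cong) (use assms in auto)
  then show ?thesis by simp
qed

lemma count_frozen:
  fixes k v h :: nat
  shows   "(\<Sum>i<k. \<Sum>j\<le>i. of_bool (i - j = v \<and> i < h)) = min k h - v"
proof -
  have "(\<Sum>j\<le>i. of_bool (i - j = v \<and> i < h) :: nat) = of_bool (v \<le> i \<and> i < h)" for i
  proof (cases "v \<le> i")
    case True
    then show ?thesis by (simp only: sum_of_bool_eq_diff simp_thms)
  next
    case False
    have "(\<Sum>j\<le>i. of_bool (i - j = v \<and> i < h) :: nat) = (\<Sum>j\<le>i. 0)"
      by (rule sum.cong) (use False in auto)
    then show ?thesis using False by simp
  qed
  then have "(\<Sum>i<k. \<Sum>j\<le>i. of_bool (i - j = v \<and> i < h) :: nat) = card ({..<k} \<inter> {i. v \<le> i \<and> i < h})"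
    by (simp add: sum_of_bool_eq)
  also have "{..<k} \<inter> {i. v \<le> i \<and> i < h} = {v..<min k h}" by auto
  finally show ?thesis by simp
qed

text \<open>The pairs are split according to whether each entry is frozen. Every remaining pair is
  governed by the decoration of at most one entry of the triangle, so the count is affine in
  \<open>U\<close>.\<close>

lemma dinv_config:
  assumes c: "(a, U) \<in> configs n"
  shows "dinv n (config_tuple n (a, U)) = adj n + (\<Sum>i<n - 1. i * Suc i)
    + (\<Sum>p\<in>tri n. n - 1 - a p) + (\<Sum>p\<in>U. rate n a (fst p) (a p))"
proof -
  define X where "X = (\<lambda>(j, i). row_area (config_tuple n (a, U) ! j) i)"
  define D where "D = (\<lambda>(j, i). decorated (config_tuple n (a, U) ! j) i)"
  \<comment> \<open>The two kinds of dinv pairs exclude each other, so their indicators may be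
    added.\<close>
  define h where "h e f = (of_bool (X e = X f \<and> snd e < snd f \<and> \<not> D e)
    + of_bool (X e = Suc (X f) \<and> snd e \<le> snd f \<and> \<not> D f) :: nat)" for e f
  have low: "X (j, i) = i - j" "\<not> D (j, i)" if "j \<le> i" "i < n - 1" for i j
    using that by (simp_all add: X_def D_def config_tuple_nth row_low[OF c])
  have high: "X (u, n - 1 + r) = a (r, u)" "D (u, n - 1 + r) \<longleftrightarrow> (r, u) \<notin> U" if "r + u < n" for r u
    using that row_high[OF c that] by (simp_all add: X_def D_def config_tuple_nth)
  have U: "U \<subseteq> tri n" using c by (simp add: configs_def)
  have fin: "finite (entry_indices n)" by (simp add: entry_indices_def)
  have "dinv_pairs n (config_tuple n (a, U)) = {(e, f) \<in> entry_indices n \<times> entry_indices n.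
      X e = X f \<and> snd e < snd f \<and> \<not> D e \<or> X e = Suc (X f) \<and> snd e \<le> snd f \<and> \<not> D f}"
    by (auto simp: dinv_pairs_def X_def D_def)
  also have "\<dots> = (SIGMA e:entry_indices n. {f \<in> entry_indices n.
      X e = X f \<and> snd e < snd f \<and> \<not> D e \<or> X e = Suc (X f) \<and> snd e \<le> snd f \<and> \<not> D f})"
    by auto
  finally have "card (dinv_pairs n (config_tuple n (a, U))) = (\<Sum>e\<in>entry_indices n. card {f \<in> entry_indices n.
      X e = X f \<and> snd e < snd f \<and> \<not> D e \<or> X e = Suc (X f) \<and> snd e \<le> snd f \<and> \<not> D f})"
    using fin by simp
  also have "\<dots> = (\<Sum>e\<in>entry_indices n. \<Sum>f\<in>entry_indices n. h e f)"
  proof (rule sum.cong[OF refl])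
    fix e
    have "card {f \<in> entry_indices n. X e = X f \<and> snd e < snd f \<and> \<not> D e \<or> X e = Suc (X f) \<and> snd e \<le> snd f \<and> \<not> D f}
        = (\<Sum>f\<in>entry_indices n. of_bool (X e = X f \<and> snd e < snd f \<and> \<not> D e \<or> X e = Suc (X f) \<and> snd e \<le> snd f \<and> \<not> D f))"
      by (rule card_eq_sum_of_bool[OF fin])
    also have "\<dots> = (\<Sum>f\<in>entry_indices n. h e f)"
      by (rule sum.cong[OF refl]) (auto simp: h_def of_bool_def)
    finally show "card {f \<in> entry_indices n. X e = X f \<and> snd e < snd f \<and> \<not> D e \<or> X e = Suc (X f) \<and> snd e \<le> snd f \<and> \<not> D f}
        = (\<Sum>f\<in>entry_indices n. h e f)" .
  qed
  also have "\<dots> = (\<Sum>f\<in>entry_indices n. \<Sum>e\<in>entry_indices n. h e f)"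
    by (rule sum.swap)
  also have "\<dots> = (\<Sum>i<n - 1. i * Suc i) + (\<Sum>p\<in>tri n. n - 1 - a p) + (\<Sum>p\<in>U. rate n a (fst p) (a p))"
  proof -
    \<comment> \<open>Each kind of pair contributes \<open>j'\<close>: the value
      \<open>i' - j'\<close> occurs in \<open>j'\<close> earlier strips, and
      \<open>Suc (i' - j')\<close> in \<open>j'\<close> strips up to \<open>i'\<close>.\<close>
    have low_low: "(\<Sum>i<n - 1. \<Sum>j\<le>i. h (j, i) (j', i')) = 2 * j'" if f: "j' \<le> i'" "i' < n - 1" for i' j'
    proof -
      have "(\<Sum>i<n - 1. \<Sum>j\<le>i. h (j, i) (j', i'))
          = (\<Sum>i<n - 1. \<Sum>j\<le>i. of_bool (i - j = i' - j' \<and> i < i') + of_bool (i - j = Suc (i' - j') \<and> i < Suc i'))"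
      proof (intro sum.cong refl)
        fix i j assume "i \<in> {..<n - 1}" "j \<in> {..i}"
        then have e: "j \<le> i" "i < n - 1" by simp_all
        show "h (j, i) (j', i') = of_bool (i - j = i' - j' \<and> i < i') + of_bool (i - j = Suc (i' - j') \<and> i < Suc i')"
          unfolding h_def low(1)[OF e] low(1)[OF f] using low(2)[OF e] low(2)[OF f]
          by (simp only: snd_conv less_Suc_eq_le simp_thms)
      qed
      also have "\<dots> = 2 * j'"
        unfolding sum.distrib count_frozen using f by simp
      finally show ?thesis .
    qed
    have high_low: "(\<Sum>(r, u)\<in>tri n. h (u, n - 1 + r) (j', i')) = 0" if "i' < n - 1" for i' j'
      by (rule sum.neutral) (use that in \<open>auto simp: h_def\<close>)
    \<comment> \<open>Frozen entries are undecorated, so equal values always count; frozen values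
      larger by 1 count only if \<open>(r, u)\<close> is undecorated.\<close>
    have low_high: "(\<Sum>i<n - 1. \<Sum>j\<le>i. h (j, i) (u, n - 1 + r))
        = (n - 1 - a (r, u)) + of_bool ((r, u) \<in> U) * (n - 2 - a (r, u))" if f: "r + u < n" for r u
    proof -
      have "(\<Sum>i<n - 1. \<Sum>j\<le>i. h (j, i) (u, n - 1 + r))
          = (\<Sum>i<n - 1. \<Sum>j\<le>i. of_bool (i - j = a (r, u) \<and> i < n - 1)
            + of_bool ((r, u) \<in> U) * of_bool (i - j = Suc (a (r, u)) \<and> i < n - 1))"
      proof (intro sum.cong refl)
        fix i j assume "i \<in> {..<n - 1}" "j \<in> {..i}"
        then have e: "j \<le> i" "i < n - 1" by simp_all
        then have "i < n - 1 + r" "i \<le> n - 1 + r" by simp_all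
        then show "h (j, i) (u, n - 1 + r) = of_bool (i - j = a (r, u) \<and> i < n - 1)
            + of_bool ((r, u) \<in> U) * of_bool (i - j = Suc (a (r, u)) \<and> i < n - 1)"
          unfolding h_def low(1)[OF e] high[OF f] of_bool_conj[symmetric] using low(2)[OF e] e(2)
          by (simp only: snd_conv simp_thms conj_commute)
      qed
      also have "\<dots> = (n - 1 - a (r, u)) + of_bool ((r, u) \<in> U) * (n - 1 - Suc (a (r, u)))"
        unfolding sum.distrib sum_distrib_left[symmetric] count_frozen by simp
      finally show ?thesis by simp
    qed
    have "(\<Sum>f\<in>entry_indices n. \<Sum>e\<in>entry_indices n. h e f)
        = (\<Sum>i'<n - 1. \<Sum>j'\<le>i'. 2 * j')
        + (\<Sum>(r, u)\<in>tri n. (n - 1 - a (r, u)) + of_bool ((r, u) \<in> U) * (n - 2 - a (r, u))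
            + (\<Sum>(s, w)\<in>tri n. h (w, n - 1 + s) (u, n - 1 + r)))"
    proof -
      have "(\<Sum>e\<in>entry_indices n. h e (j', i')) = 2 * j'" if "j' \<le> i'" "i' < n - 1" for j' i'
        unfolding sum_entries low_low[OF that] high_low[OF that(2)] by simp
      moreover have "(\<Sum>e\<in>entry_indices n. h e (u, n - 1 + r))
          = (n - 1 - a (r, u)) + of_bool ((r, u) \<in> U) * (n - 2 - a (r, u))
            + (\<Sum>(s, w)\<in>tri n. h (w, n - 1 + s) (u, n - 1 + r))" if "r + u < n" for r u
        unfolding sum_entries low_high[OF that] ..
      ultimately show ?thesis
        unfolding sum_entries[of "\<lambda>f. \<Sum>e\<in>entry_indices n. h e f"]
        by (intro arg_cong2[of _ _ _ _ "(+)"] sum.cong refl)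
          (simp_all only: lessThan_iff atMost_iff split_paired_all mem_tri prod.case)
    qed
    also have "(\<Sum>i'<n - 1. \<Sum>j'\<le>i'. 2 * j') = (\<Sum>i<n - 1. i * Suc i)"
      by (simp only: mult_2 sum.distrib two_sum_atMost)
    also have "(\<Sum>(r, u)\<in>tri n. (n - 1 - a (r, u)) + of_bool ((r, u) \<in> U) * (n - 2 - a (r, u))
            + (\<Sum>(s, w)\<in>tri n. h (w, n - 1 + s) (u, n - 1 + r)))
        = (\<Sum>p\<in>tri n. n - 1 - a p) + (\<Sum>p\<in>tri n. of_bool (p \<in> U) * (n - 2 - a p))
          + (\<Sum>p\<in>tri n. \<Sum>s\<in>tri n. of_bool (s \<in> U \<and> fst s < fst p \<and> a p = a s)
            + of_bool (p \<in> U \<and> fst s \<le> fst p \<and> a s = Suc (a p)))"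
    proof -
      have high_high: "h (w, n - 1 + s) (u, n - 1 + r) = of_bool ((s, w) \<in> U \<and> s < r \<and> a (r, u) = a (s, w))
          + of_bool ((r, u) \<in> U \<and> s \<le> r \<and> a (s, w) = Suc (a (r, u)))"
        if "r + u < n" "s + w < n" for r u s w
        unfolding h_def high[OF that(1)] high[OF that(2)] by (simp add: of_bool_def)
      have "(\<Sum>(s, w)\<in>tri n. h (w, n - 1 + s) (u, n - 1 + r))
          = (\<Sum>s\<in>tri n. of_bool (s \<in> U \<and> fst s < r \<and> a (r, u) = a s)
            + of_bool ((r, u) \<in> U \<and> fst s \<le> r \<and> a s = Suc (a (r, u))))" if "r + u < n" for r u
        by (rule sum.cong[OF refl]) (simp only: split_paired_all mem_tri prod.case fst_conv high_high[OF that])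
      then show ?thesis
        unfolding sum.distrib[symmetric, of _ "tri n"]
        by (intro sum.cong refl) (simp only: split_paired_all mem_tri prod.case fst_conv)
    qed
    also have "(\<Sum>p\<in>tri n. \<Sum>s\<in>tri n. of_bool (s \<in> U \<and> fst s < fst p \<and> a p = a s)
            + of_bool (p \<in> U \<and> fst s \<le> fst p \<and> a s = Suc (a p)))
        = (\<Sum>p\<in>tri n. of_bool (p \<in> U) * (\<Sum>s\<in>tri n. of_bool (fst p < fst s \<and> a s = a p)
            + of_bool (fst s \<le> fst p \<and> a s = Suc (a p))) :: nat)"
    proof -
      \<comment> \<open>For equal values the first entry must be undecorated, for a difference of 1
        the second. Exchanging the names in the former case collects both at the undecorated entry,
        giving \<open>rate\<close>.\<close>
      have "(\<Sum>p\<in>tri n. \<Sum>s\<in>tri n. of_bool (s \<in> U \<and> fst s < fst p \<and> a p = a s) :: nat)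
          = (\<Sum>p\<in>tri n. \<Sum>s\<in>tri n. of_bool (p \<in> U \<and> fst p < fst s \<and> a s = a p))"
        by (rule sum.swap)
      then have "(\<Sum>p\<in>tri n. \<Sum>s\<in>tri n. of_bool (s \<in> U \<and> fst s < fst p \<and> a p = a s)
            + of_bool (p \<in> U \<and> fst s \<le> fst p \<and> a s = Suc (a p)))
          = (\<Sum>p\<in>tri n. \<Sum>s\<in>tri n. of_bool (p \<in> U \<and> fst p < fst s \<and> a s = a p)
            + of_bool (p \<in> U \<and> fst s \<le> fst p \<and> a s = Suc (a p)) :: nat)"
        unfolding sum.distrib by (simp only:)
      also have "\<dots> = (\<Sum>p\<in>tri n. of_bool (p \<in> U) * (\<Sum>s\<in>tri n. of_bool (fst p < fst s \<and> a s = a p)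
            + of_bool (fst s \<le> fst p \<and> a s = Suc (a p))))"
        unfolding sum_distrib_left distrib_left of_bool_conj ..
      finally show ?thesis .
    qed
    also have "(\<Sum>p\<in>tri n. n - 1 - a p) + (\<Sum>p\<in>tri n. of_bool (p \<in> U) * (n - 2 - a p))
          + (\<Sum>p\<in>tri n. of_bool (p \<in> U) * (\<Sum>s\<in>tri n. of_bool (fst p < fst s \<and> a s = a p)
            + of_bool (fst s \<le> fst p \<and> a s = Suc (a p))))
        = (\<Sum>p\<in>tri n. n - 1 - a p) + (\<Sum>p\<in>tri n. of_bool (p \<in> U) * rate n a (fst p) (a p))"
      unfolding rate_def distrib_left sum.distrib by simp
    also have "(\<Sum>p\<in>tri n. of_bool (p \<in> U) * rate n a (fst p) (a p)) = (\<Sum>p\<in>U. rate n a (fst p) (a p))"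
      using U by (simp add: of_bool_def if_distrib[of "\<lambda>x. x * _"] sum.inter_restrict[symmetric] Int_absorb1 cong: if_cong)
    finally show ?thesis by (simp add: add.assoc)
  qed
  finally show ?thesis by (simp add: dinv_def)
qed

text \<open>Induction on the doubled identity, which is free of division.\<close>

lemma area_exponent: "(\<Sum>i<m. \<Sum>{..i}) + (\<Sum>k<Suc m. k * Suc k) = (Suc m)\<^sup>2 * m div 2" for m :: nat
proof -
  have "2 * ((\<Sum>i<m. \<Sum>{..i}) + (\<Sum>k<Suc m. k * Suc k)) = (Suc m)\<^sup>2 * m"
  proof (induction m)
    case (Suc m)
    then show ?case using two_sum_atMost[of m] by (simp add: power2_eq_square algebra_simps)
  qed simp
  moreover have "2 * x = y \<Longrightarrow> x = y div 2" for x y :: nat by auto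
  ultimately show ?thesis by blast
qed

text \<open>Since \<open>adj (Suc m)\<close> is \<open>\<Sum>{..m}\<close>, it combines with the
  last term of the third sum to \<open>m * Suc m\<close>, which reduces the claim to
  \<open>area_exponent\<close>.\<close>

lemma dinv_exponent:
  "adj (Suc m) + (\<Sum>i<m. i * Suc i) + (\<Sum>k<Suc m. \<Sum>{..k}) = (Suc m)\<^sup>2 * m div 2"
proof -
  have "adj (Suc m) = \<Sum>{..m}"
    using two_sum_atMost[of m] by (simp add: adj_def choose_two algebra_simps)
  then show ?thesis
    using two_sum_atMost[of m] area_exponent[of m] by simp
qed

theorem theorem1p3:
  fixes n :: nat and z q t :: "'a :: comm_ring_1"
  assumes "n \<ge> 1"
  shows "(\<Sum>\<pi>\<in>path_tuples n. z ^ diags \<pi> * q ^ area n \<pi> * t ^ dinv n \<pi>) =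
    (q * t) ^ (n\<^sup>2 * (n - 1) div 2) * (\<Prod>(i, j)\<in>{(i, j). i + j < n}. z + q ^ i * t ^ j)"
proof -
  obtain m where n: "n = Suc m" using assms by (cases n) auto
  let ?K = "\<Sum>i<m. \<Sum>{..i}" and ?L = "adj n + (\<Sum>i<m. i * Suc i)"
  have "(\<Sum>\<pi>\<in>path_tuples n. z ^ diags \<pi> * q ^ area n \<pi> * t ^ dinv n \<pi>)
      = (\<Sum>x\<in>configs n. z ^ diags (config_tuple n x) * q ^ area n (config_tuple n x) * t ^ dinv n (config_tuple n x))"
    by (rule sum.reindex_bij_betw[OF config_tuple_bij, symmetric])
  also have "\<dots> = (\<Sum>(a, U)\<in>configs n. q ^ ?K * t ^ ?L * weight n z 1 q t a U)"
    by (rule sum.cong[OF refl])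
      (auto simp: weight_def diags_config area_config dinv_config n power_add mult_ac)
  also have "\<dots> = q ^ ?K * t ^ ?L * config_sum n z 1 q t"
    by (simp add: config_sum_def sum_distrib_left case_prod_unfold)
  also have "\<dots> = q ^ (?K + (\<Sum>k<n. k * Suc k)) * t ^ (?L + (\<Sum>k<n. \<Sum>{..k}))
      * (\<Prod>(i, j)\<in>tri n. z + q ^ i * t ^ j)"
    unfolding config_sum_eq by (simp add: power_add mult_ac)
  also have "\<dots> = (q * t) ^ (n\<^sup>2 * (n - 1) div 2) * (\<Prod>(i, j)\<in>tri n. z + q ^ i * t ^ j)"
    unfolding n area_exponent dinv_exponent by (simp add: power_mult_distrib)
  finally show ?thesis unfolding tri_def .
qed

end
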